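(* Let $M$ be a $\sigma$-compact metric space having a good covering $\mathcal U$. Then $M$ has the same locally Lipschitz homotopy type as (the geometric realization $|\mathcal N_{\mathcal U}|$ of) the nerve of $\mathcal U$; that is, $M$ and $|\mathcal N_{\mathcal U}|$ are locally Lipschitz homotopy equivalent.
   Context: The distance between points $x,y$ of a metric space is written $|x,y|$. Products of metric spaces carry the product metric (square root of the sum of squares). Lipschitz strong deformation retraction: for a subset $A$ of a metric space $X$, a Lipschitz map $F:X\times[0,1]\to X$ with $F(x,0)=x$, $F(x,1)\in A$ and $F(a,t)=a$ for all $x\in X$, $a\in A$, $t\in[0,1]$ is a Lipschitz strong deformation retraction of $X$ to $A$. Good covering: a locally finite open covering $\mathcal U=\{U_j\}_{j\in J}$ of a metric space $X$ is good if (1) the closure of each element of $\mathcal U$ is compact; (2) every non-empty intersection $\bigcap_{i=0}^k U_{j_i}$ of finitely many elements of $\mathcal U$ has a Lipschitz strong deformation retraction to a point $p$ of it. Nerve: $\mathcal N_{\mathcal U}$ is the simplicial complex whose vertices are the non-empty elements of $\mathcal U$ and whose $k$-simplices are the unordered $(k+1)$-tuples $\langle U_{j_0},\dots,U_{j_k}\rangle$ of (distinct) elements with $\bigcap_{i=0}^k U_{j_i}\ne\emptyset$. By local finiteness and $\sigma$-compactness $J$ is countable. The geometric realization $|\mathcal N_{\mathcal U}|$ is realized in $\mathbb R^{J}$ (finitely supported vectors; $\mathbb R^\infty$ if $J$ is infinite) with the $j$-th vertex $\langle U_j\rangle$ placed at the $j$-th standard unit vector, and carries the metric $d(x,y)=\max_{j}|x_j-y_j|$.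 Two maps $h_0,h_1:X\to Y$ of metric spaces are locally Lipschitz homotopic if there is a locally Lipschitz map $h:X\times[0,1]\to Y$ with $h(\cdot,i)=h_i$ ($i=0,1$). $X$ and $Y$ are locally Lipschitz homotopy equivalent (have the same locally Lipschitz homotopy type) if there are locally Lipschitz maps $f:X\to Y$, $g:Y\to X$ such that $g\circ f$ and $f\circ g$ are locally Lipschitz homotopic to $1_X$ and $1_Y$ respectively. *)

theory Defs
  imports "HOL-Analysis.Analysis" "HOL-Library.Poly_Mapping"
begin

section \<open>Compactness and coverings\<close>

definition sigma_compact_space :: "'a topology \<Rightarrow> bool" where
  "sigma_compact_space X \<longleftrightarrow>
     (\<exists>\<K>. countable \<K> \<and> (\<forall>K\<in>\<K>. compactin X K) \<and> \<Union>\<K> = topspace X)"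

text \<open>Coverings are indexed families, and local finiteness counts indices. A covering given as a
  set of sets is the case where the family is the identity, so that the indices are the sets.\<close>

definition locally_finite_open_covering :: "'a metric \<Rightarrow> 'j set \<Rightarrow> ('j \<Rightarrow> 'a set) \<Rightarrow> bool" where
  "locally_finite_open_covering X J U \<longleftrightarrow>
     (\<forall>j\<in>J. openin (mtopology_of X) (U j)) \<and>
     (\<Union>j\<in>J. U j) = mspace X \<and>
     (\<forall>x\<in>mspace X. \<exists>V. openin (mtopology_of X) V \<and> x \<in> V \<and> finite {j\<in>J. U j \<inter> V \<noteq> {}})"


section \<open>Lipschitz retractions and good coverings\<close>

abbreviation unit_interval_metric :: "real metric" where
  "unit_interval_metric \<equiv> submetric euclidean_metric {0..1}"

definition Lipschitz_strong_deformation_retraction ::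
    "'a metric \<Rightarrow> 'a set \<Rightarrow> ('a \<times> real \<Rightarrow> 'a) \<Rightarrow> bool" where
  "Lipschitz_strong_deformation_retraction X A F \<longleftrightarrow>
     A \<subseteq> mspace X \<and>
     Lipschitz_continuous_map (prod_metric X unit_interval_metric) X F \<and>
     (\<forall>x\<in>mspace X. F (x, 0) = x) \<and>
     (\<forall>x\<in>mspace X. F (x, 1) \<in> A) \<and>
     (\<forall>a\<in>A. \<forall>t\<in>{0..1}. F (a, t) = a)"

definition good_covering :: "'a metric \<Rightarrow> 'j set \<Rightarrow> ('j \<Rightarrow> 'a set) \<Rightarrow> bool" where
  "good_covering X J U \<longleftrightarrow>
     locally_finite_open_covering X J U \<and>
     (\<forall>j\<in>J. compactin (mtopology_of X) (mtopology_of X closure_of U j)) \<and>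
     (\<forall>s. s \<subseteq> J \<and> finite s \<and> s \<noteq> {} \<and> (\<Inter>j\<in>s. U j) \<noteq> {} \<longrightarrow>
        (\<exists>p\<in>(\<Inter>j\<in>s. U j). \<exists>F.
           Lipschitz_strong_deformation_retraction (submetric X (\<Inter>j\<in>s. U j)) {p} F))"


section \<open>The nerve and its geometric realization\<close>

definition nerve :: "'j set \<Rightarrow> ('j \<Rightarrow> 'a set) \<Rightarrow> 'j set set" where
  "nerve J U = {s. s \<subseteq> J \<and> finite s \<and> s \<noteq> {} \<and> (\<Inter>j\<in>s. U j) \<noteq> {}}"

text \<open>The finitely supported vectors are \<open>'j \<Rightarrow>\<^sub>0 real\<close>, with standard unit vectors
  \<open>Poly_Mapping.single j 1\<close>. The maximum is over the whole index type; on vectors supported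
  in a nonempty \<open>J\<close> it is the maximum over \<open>J\<close>, since the other coordinates vanish.\<close>

definition max_dist :: "('j \<Rightarrow>\<^sub>0 real) \<Rightarrow> ('j \<Rightarrow>\<^sub>0 real) \<Rightarrow> real" where
  "max_dist x y = Max (range (\<lambda>j. \<bar>Poly_Mapping.lookup x j - Poly_Mapping.lookup y j\<bar>))"

definition max_metric :: "('j \<Rightarrow>\<^sub>0 real) metric" where
  "max_metric = metric (UNIV, max_dist)"

lemma finite_range_abs_diff:
  "finite (range (\<lambda>j. \<bar>Poly_Mapping.lookup x j - Poly_Mapping.lookup y j\<bar>))"
  for x y :: "'j \<Rightarrow>\<^sub>0 real"
proof -
  let ?f = "\<lambda>j. \<bar>Poly_Mapping.lookup x j - Poly_Mapping.lookup y j\<bar>"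
  have "range ?f \<subseteq> insert 0 (?f ` (Poly_Mapping.keys x \<union> Poly_Mapping.keys y))"
    by (auto simp: image_iff in_keys_iff)
  then show ?thesis
    by (rule finite_subset) auto
qed

lemma abs_diff_le_max_dist: "\<bar>Poly_Mapping.lookup x j - Poly_Mapping.lookup y j\<bar> \<le> max_dist x y"
  unfolding max_dist_def by (rule Max_ge[OF finite_range_abs_diff]) auto

lemma max_dist_le_iff:
  "max_dist x y \<le> c \<longleftrightarrow> (\<forall>j. \<bar>Poly_Mapping.lookup x j - Poly_Mapping.lookup y j\<bar> \<le> c)"
  unfolding max_dist_def by (subst Max_le_iff[OF finite_range_abs_diff]) auto

lemma Metric_space_max_dist: "Metric_space UNIV max_dist"
proof
  fix x y z :: "'j \<Rightarrow>\<^sub>0 real"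
  show nonneg: "0 \<le> max_dist x y" for x y :: "'j \<Rightarrow>\<^sub>0 real"
    using abs_diff_le_max_dist[of x _ y] abs_ge_zero order_trans by blast
  show "max_dist x y = max_dist y x"
    by (simp add: max_dist_def abs_minus_commute)
  have "max_dist x y = 0 \<longleftrightarrow> max_dist x y \<le> 0"
    using nonneg[of x y] by linarith
  then show "max_dist x y = 0 \<longleftrightarrow> x = y"
    by (simp add: max_dist_le_iff poly_mapping_eq_iff fun_eq_iff)
  show "max_dist x z \<le> max_dist x y + max_dist y z"
    unfolding max_dist_le_iff
  proof
    fix j
    show "\<bar>Poly_Mapping.lookup x j - Poly_Mapping.lookup z j\<bar> \<le> max_dist x y + max_dist y z"
      using abs_diff_le_max_dist[of x j y] abs_diff_le_max_dist[of y j z] by linarith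
  qed
qed

lemma mspace_max_metric [simp]: "mspace max_metric = UNIV"
  by (simp add: max_metric_def Metric_space.mspace_metric[OF Metric_space_max_dist])

lemma mdist_max_metric [simp]: "mdist max_metric = max_dist"
  by (simp add: max_metric_def Metric_space.mdist_metric[OF Metric_space_max_dist])

text \<open>The convex hull of the unit vectors indexed by \<open>s\<close>.\<close>

definition realized_simplex :: "'j set \<Rightarrow> ('j \<Rightarrow>\<^sub>0 real) set" where
  "realized_simplex s =
     {(\<Sum>j\<in>s. Poly_Mapping.single j (t j)) | t. (\<forall>j\<in>s. 0 \<le> t j) \<and> (\<Sum>j\<in>s. t j) = 1}"

definition geometric_realization :: "'j set set \<Rightarrow> ('j \<Rightarrow>\<^sub>0 real) metric" where
  "geometric_realization K = submetric max_metric (\<Union>s\<in>K. realized_simplex s)"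


section \<open>Locally Lipschitz homotopy equivalence\<close>

definition locally_Lipschitz_map :: "'a metric \<Rightarrow> 'b metric \<Rightarrow> ('a \<Rightarrow> 'b) \<Rightarrow> bool" where
  "locally_Lipschitz_map X Y f \<longleftrightarrow>
     f \<in> mspace X \<rightarrow> mspace Y \<and>
     (\<forall>x\<in>mspace X. \<exists>V. openin (mtopology_of X) V \<and> x \<in> V \<and>
        Lipschitz_continuous_map (submetric X V) Y f)"

definition locally_Lipschitz_homotopic ::
    "'a metric \<Rightarrow> 'b metric \<Rightarrow> ('a \<Rightarrow> 'b) \<Rightarrow> ('a \<Rightarrow> 'b) \<Rightarrow> bool" where
  "locally_Lipschitz_homotopic X Y h0 h1 \<longleftrightarrow>
     (\<exists>h. locally_Lipschitz_map (prod_metric X unit_interval_metric) Y h \<and>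
        (\<forall>x\<in>mspace X. h (x, 0) = h0 x \<and> h (x, 1) = h1 x))"

definition locally_Lipschitz_homotopy_equivalent :: "'a metric \<Rightarrow> 'b metric \<Rightarrow> bool" where
  "locally_Lipschitz_homotopy_equivalent X Y \<longleftrightarrow>
     (\<exists>f g. locally_Lipschitz_map X Y f \<and> locally_Lipschitz_map Y X g \<and>
        locally_Lipschitz_homotopic X X (g \<circ> f) id \<and>
        locally_Lipschitz_homotopic Y Y (f \<circ> g) id)"

end

theory Submission
  imports Defs
begin

text \<open>The map from \<open>M\<close> to the nerve sends \<open>x\<close> to the point whose barycentric coordinates are
  proportional to the distances, cut off at \<open>1\<close>, from \<open>x\<close> to the complements of the \<open>U j\<close>. The
  map back is built directly from the given contractions \<open>F \<sigma>\<close> of the intersections \<open>\<Inter>j\<in>\<sigma>. U j\<close>, without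
  subdividing the nerve or gluing maps on its simplices.

  Let \<open>z\<close> be a vector of nonnegative coordinates, supported in a simplex. Its superlevel sets
  \<open>{j. r < z j}\<close> form a chain \<open>\<sigma>\<^sub>1 \<subset> \<dots> \<subset> \<sigma>\<^sub>k\<close> of simplices, and the set of vectors that have
  a given superlevel set \<open>\<sigma>\<close> is cut out by the gap of \<open>\<sigma>\<close>: the least coordinate in \<open>\<sigma>\<close> minus the
  greatest outside. The gap is Lipschitz in \<open>z\<close>. Starting from a point \<open>x\<close> common to all \<open>U j\<close>
  with \<open>z j \<noteq> 0\<close>, move \<open>x\<close> along \<open>F \<sigma>\<^sub>k\<close>, then along \<open>F \<sigma>\<^sub>k\<^sub>-\<^sub>1\<close>, and so on to \<open>F \<sigma>\<^sub>1\<close>,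
  each for a time \<open>weight \<sigma>\<^sub>i z\<close> that is a truncated multiple of the gap. This composite is
  \<open>slide\<close>. A larger simplex has the smaller intersection, so each motion starts where it is
  defined. Three facts carry the proof.

  \<^item> \<open>slide\<close> is Lipschitz in \<open>(x, z)\<close> as long as \<open>z\<close> is supported in a fixed finite set
    (\<open>slide_Lipschitz\<close>). A simplex that is a superlevel set of only one of two vectors contributes
    little, because \<open>F \<sigma> (x, 0) = x\<close>: its motion is at most a constant times its weight, which is
    at most a constant times the distance of the two vectors.
  \<^item> If the greatest coordinate of \<open>z\<close> is \<open>1\<close>, some superlevel set has weight \<open>1\<close>
    (\<open>exists_large_gap\<close>), so on the way the point is moved to the base point of that simplex and
    the starting point is forgotten (\<open>slide_reset\<close>). Hence a point of the nerve alone determines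
    the result, and locally it is the \<open>slide\<close> of a constant starting point.
  \<^item> The result lies in every \<open>U j\<close> for which \<open>z j\<close> is maximal (\<open>slide_in_maximal\<close>).

  For a point \<open>y\<close> of the nerve the vector \<open>z\<close> is \<open>y\<close> rescaled and cut off at half its greatest
  coordinate, so that the image of \<open>y\<close> lies in \<open>U j\<close> whenever \<open>y j\<close> is at least half of that
  maximum. The two homotopies then have closed formulas. On \<open>M\<close>, sliding \<open>x\<close> along \<open>(1 - t) z\<close>,
  where \<open>z\<close> belongs to the image of \<open>x\<close> in the nerve, joins the composite to the identity. On the
  nerve, the identity is joined linearly to the map that keeps only the part of \<open>y\<close> above half its
  maximum, and that map linearly to the composite: both are supported in the simplex of all \<open>j\<close>
  with the image of \<open>y\<close> in \<open>U j\<close>.\<close>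


section \<open>Maps that are Lipschitz near a point\<close>

abbreviation near :: "'a metric \<Rightarrow> 'a \<Rightarrow> 'a filter" where
  "near X x \<equiv> nhdsin (mtopology_of X) x"

text \<open>The Lipschitz condition is stated for pairs of points close to \<open>x\<close>, so that combining finitely
  many such conditions is a matter of intersecting eventualities. The distance \<open>d\<close> of the target is
  a parameter, so that real-valued maps use \<open>dist\<close> and the others use \<open>mdist\<close>.\<close>

definition Lipschitz_near :: "'a metric \<Rightarrow> 'a \<Rightarrow> ('b \<Rightarrow> 'b \<Rightarrow> real) \<Rightarrow> ('a \<Rightarrow> 'b) \<Rightarrow> bool" where
  "Lipschitz_near X x d f \<longleftrightarrow>
     (\<exists>C. \<forall>\<^sub>F q in near X x \<times>\<^sub>F near X x. d (f (fst q)) (f (snd q)) \<le> C * mdist X (fst q) (snd q))"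

lemma eventually_near_mspace: "\<forall>\<^sub>F u in near X x. u \<in> mspace X"
  unfolding eventually_nhdsin
  by (metis openin_topspace topspace_mtopology_of)

lemma eventually_near_ball: "0 < e \<Longrightarrow> \<forall>\<^sub>F u in near X x. mdist X u x < e"
  unfolding eventually_nhdsin
proof (cases "x \<in> mspace X")
  case True
  interpret Metric_space "mspace X" "mdist X" by simp
  assume "0 < e"
  have "openin (mtopology_of X) (mball x e)"
    by (simp add: mtopology_of_def)
  with True \<open>0 < e\<close> show "x \<notin> topspace (mtopology_of X) \<or>
     (\<exists>S. openin (mtopology_of X) S \<and> x \<in> S \<and> (\<forall>x'\<in>S. mdist X x' x < e))"
    by (intro disjI2 exI[of _ "mball x e"]) (auto simp: commute)
qed auto

lemma eventually_near_pairs: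
  assumes "\<forall>\<^sub>F u in near X x. P u"
  shows "\<forall>\<^sub>F q in near X x \<times>\<^sub>F near X x. P (fst q) \<and> P (snd q)"
  using eventually_prodI[OF assms assms] .

lemma Lipschitz_nearI:
  assumes "\<forall>\<^sub>F u in near X x. P u"
    and "\<And>u v. u \<in> mspace X \<Longrightarrow> v \<in> mspace X \<Longrightarrow> P u \<Longrightarrow> P v \<Longrightarrow> d (f u) (f v) \<le> C * mdist X u v"
  shows "Lipschitz_near X x d f"
proof -
  have "\<forall>\<^sub>F q in near X x \<times>\<^sub>F near X x. d (f (fst q)) (f (snd q)) \<le> C * mdist X (fst q) (snd q)"
    using eventually_near_pairs[OF assms(1)] eventually_near_pairs[OF eventually_near_mspace]
    by eventually_elim (use assms(2) in blast)
  then show ?thesis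
    unfolding Lipschitz_near_def by blast
qed

lemma Lipschitz_nearE:
  assumes "Lipschitz_near X x d f"
  obtains C where "C \<ge> 0" "\<forall>\<^sub>F q in near X x \<times>\<^sub>F near X x.
    d (f (fst q)) (f (snd q)) \<le> C * mdist X (fst q) (snd q)"
proof -
  obtain C where C: "\<forall>\<^sub>F q in near X x \<times>\<^sub>F near X x.
      d (f (fst q)) (f (snd q)) \<le> C * mdist X (fst q) (snd q)"
    using assms unfolding Lipschitz_near_def by blast
  have "\<forall>\<^sub>F q in near X x \<times>\<^sub>F near X x.
      d (f (fst q)) (f (snd q)) \<le> max C 0 * mdist X (fst q) (snd q)"
    using C
  proof eventually_elim
    case (elim q)
    also have "C * mdist X (fst q) (snd q) \<le> max C 0 * mdist X (fst q) (snd q)"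
      by (intro mult_right_mono) (auto simp: mdist_nonneg)
    finally show ?case .
  qed
  then show thesis using that[of "max C 0"] by simp
qed

lemma Lipschitz_near_cong:
  assumes "Lipschitz_near X x d g" "\<forall>\<^sub>F u in near X x. f u = g u"
  shows "Lipschitz_near X x d f"
proof -
  obtain C where C: "\<forall>\<^sub>F q in near X x \<times>\<^sub>F near X x.
      d (g (fst q)) (g (snd q)) \<le> C * mdist X (fst q) (snd q)"
    using assms(1) unfolding Lipschitz_near_def by blast
  have "\<forall>\<^sub>F q in near X x \<times>\<^sub>F near X x. d (f (fst q)) (f (snd q)) \<le> C * mdist X (fst q) (snd q)"
    using C eventually_near_pairs[OF assms(2)] by eventually_elim simp
  then show ?thesis unfolding Lipschitz_near_def by blast
qed

text \<open>Every neighbourhood of \<open>x\<close> contains \<open>x\<close>, so \<open>x\<close> itself may be the second point of the pair.\<close>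

lemma pairs_at_base_point:
  assumes "x \<in> mspace X" and "\<forall>\<^sub>F q in near X x \<times>\<^sub>F near X x. P (fst q) (snd q)"
  shows "\<forall>\<^sub>F u in near X x. P u x"
proof -
  obtain Q where Q: "eventually Q (near X x)" "\<And>u v. Q u \<Longrightarrow> Q v \<Longrightarrow> P u v"
    using assms(2) unfolding eventually_prod_same by auto
  have "Q x"
    using Q(1) assms(1) unfolding eventually_nhdsin by auto
  with Q show ?thesis by (metis (mono_tags, lifting) eventually_mono)
qed

lemma Lipschitz_near_continuous:
  assumes f: "Lipschitz_near X x d f" and x: "x \<in> mspace X" and "0 < e"
  shows "\<forall>\<^sub>F u in near X x. d (f u) (f x) < e"
proof -
  obtain C where C: "C \<ge> 0" "\<forall>\<^sub>F q in near X x \<times>\<^sub>F near X x.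
      d (f (fst q)) (f (snd q)) \<le> C * mdist X (fst q) (snd q)"
    using f by (rule Lipschitz_nearE)
  have "0 < e / (C + 1)" using \<open>0 < e\<close> C by simp
  from eventually_near_ball[OF this] pairs_at_base_point[OF x C(2)]
  show ?thesis
  proof eventually_elim
    case (elim u)
    have "d (f u) (f x) \<le> C * mdist X u x" by (rule elim)
    also have "\<dots> \<le> (C + 1) * mdist X u x"
      by (simp add: mdist_nonneg distrib_right)
    also have "\<dots> < e"
      using elim(1) C by (simp add: field_simps)
    finally show ?case .
  qed
qed

lemma filterlim_nearI:
  assumes "f x \<in> mspace Y" "\<forall>\<^sub>F u in near X x. f u \<in> mspace Y"
    and "\<And>e. 0 < e \<Longrightarrow> \<forall>\<^sub>F u in near X x. mdist Y (f u) (f x) < e"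
  shows "filterlim f (near Y (f x)) (near X x)"
  unfolding filterlim_iff
proof (intro allI impI)
  interpret Metric_space "mspace Y" "mdist Y" by simp
  fix P assume "eventually P (near Y (f x))"
  then obtain S where S: "openin (mtopology_of Y) S" "f x \<in> S" "\<forall>y\<in>S. P y"
    unfolding eventually_nhdsin using assms(1) by auto
  then obtain e where e: "0 < e" "mball (f x) e \<subseteq> S"
    unfolding mtopology_of_def openin_mtopology by blast
  from assms(3)[OF e(1)] assms(2) show "\<forall>\<^sub>F u in near X x. P (f u)"
    by eventually_elim (use S e assms(1) in \<open>auto simp: subset_iff commute\<close>)
qed

lemma filterlim_near:
  assumes "Lipschitz_near X x (mdist Y) f" "x \<in> mspace X" "f \<in> mspace X \<rightarrow> mspace Y"
  shows "filterlim f (near Y (f x)) (near X x)"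
proof (rule filterlim_nearI)
  show "\<forall>\<^sub>F u in near X x. f u \<in> mspace Y"
    using eventually_near_mspace[of X x] by eventually_elim (use assms(3) in auto)
qed (use assms Lipschitz_near_continuous[OF assms(1,2)] in auto)

lemma Lipschitz_near_compose:
  assumes f: "Lipschitz_near X x (mdist Y) f" "x \<in> mspace X" "f \<in> mspace X \<rightarrow> mspace Y"
    and h: "Lipschitz_near Y (f x) d h"
  shows "Lipschitz_near X x d (\<lambda>u. h (f u))"
proof -
  obtain C where C: "C \<ge> 0" "\<forall>\<^sub>F q in near X x \<times>\<^sub>F near X x.
      mdist Y (f (fst q)) (f (snd q)) \<le> C * mdist X (fst q) (snd q)"
    using f(1) by (rule Lipschitz_nearE)
  obtain D where D: "D \<ge> 0" "\<forall>\<^sub>F q in near Y (f x) \<times>\<^sub>F near Y (f x).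
      d (h (fst q)) (h (snd q)) \<le> D * mdist Y (fst q) (snd q)"
    using h by (rule Lipschitz_nearE)
  obtain Q where Q: "eventually Q (near Y (f x))"
    "\<And>u v. Q u \<Longrightarrow> Q v \<Longrightarrow> d (h u) (h v) \<le> D * mdist Y u v"
    using D(2) unfolding eventually_prod_same by auto
  have "\<forall>\<^sub>F u in near X x. Q (f u)"
    using filterlim_near[OF f] Q(1) by (simp add: filterlim_iff)
  from eventually_near_pairs[OF this] C(2)
  have "\<forall>\<^sub>F q in near X x \<times>\<^sub>F near X x.
      d (h (f (fst q))) (h (f (snd q))) \<le> (D * C) * mdist X (fst q) (snd q)"
  proof eventually_elim
    case (elim q)
    then have "d (h (f (fst q))) (h (f (snd q))) \<le> D * mdist Y (f (fst q)) (f (snd q))"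
      using Q(2) by blast
    also have "\<dots> \<le> D * (C * mdist X (fst q) (snd q))"
      using elim D(1) by (intro mult_left_mono) auto
    finally show ?case by (simp add: mult.assoc)
  qed
  then show ?thesis unfolding Lipschitz_near_def by blast
qed

text \<open>The bridge between local Lipschitz maps and the pointwise notion, through which all further
  Lipschitz estimates are made.\<close>

lemma locally_Lipschitz_map_iff:
  "locally_Lipschitz_map X Y f \<longleftrightarrow>
     f \<in> mspace X \<rightarrow> mspace Y \<and> (\<forall>x\<in>mspace X. Lipschitz_near X x (mdist Y) f)"
proof -
  have "(\<exists>V. openin (mtopology_of X) V \<and> x \<in> V \<and> Lipschitz_continuous_map (submetric X V) Y f)
        \<longleftrightarrow> Lipschitz_near X x (mdist Y) f"
    if f: "f \<in> mspace X \<rightarrow> mspace Y" and x: "x \<in> mspace X" for x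
  proof
    assume "\<exists>V. openin (mtopology_of X) V \<and> x \<in> V \<and> Lipschitz_continuous_map (submetric X V) Y f"
    then obtain V C where V: "openin (mtopology_of X) V" "x \<in> V"
      and C: "\<forall>u\<in>V \<inter> mspace X. \<forall>v\<in>V \<inter> mspace X. mdist Y (f u) (f v) \<le> C * mdist X u v"
      unfolding Lipschitz_continuous_map_def by auto
    show "Lipschitz_near X x (mdist Y) f"
    proof (rule Lipschitz_nearI)
      show "\<forall>\<^sub>F u in near X x. u \<in> V"
        using V unfolding eventually_nhdsin by blast
    qed (use C in auto)
  next
    assume "Lipschitz_near X x (mdist Y) f"
    then obtain C where "\<forall>\<^sub>F q in near X x \<times>\<^sub>F near X x.
      mdist Y (f (fst q)) (f (snd q)) \<le> C * mdist X (fst q) (snd q)"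
      unfolding Lipschitz_near_def by blast
    then obtain Q where Q: "eventually Q (near X x)"
      "\<And>u v. Q u \<Longrightarrow> Q v \<Longrightarrow> mdist Y (f u) (f v) \<le> C * mdist X u v"
      unfolding eventually_prod_same by auto
    then obtain V where V: "openin (mtopology_of X) V" "x \<in> V" "\<forall>u\<in>V. Q u"
      unfolding eventually_nhdsin using x by auto
    moreover have "Lipschitz_continuous_map (submetric X V) Y f"
      unfolding Lipschitz_continuous_map_def using f V(3) Q(2)
      by (auto intro!: exI[of _ C])
    ultimately show "\<exists>V. openin (mtopology_of X) V \<and> x \<in> V \<and>
        Lipschitz_continuous_map (submetric X V) Y f"
      by blast
  qed
  then show ?thesis
    unfolding locally_Lipschitz_map_def by (intro conj_cong ball_cong refl) auto
qed

lemma mdist_prod_components: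
  "mdist X (fst p) (fst q) \<le> mdist (prod_metric X Y) p q"
  "mdist Y (snd p) (snd q) \<le> mdist (prod_metric X Y) p q"
  by (auto simp: prod_dist_def case_prod_unfold)

lemma Lipschitz_near_prod_fst:
  "Lipschitz_near (prod_metric X Y) p (mdist X) fst"
  by (rule Lipschitz_nearI[where P="\<lambda>_. True" and C=1])
     (simp_all del: mdist_prod_metric add: mdist_prod_components)

lemma Lipschitz_near_prod_snd:
  "Lipschitz_near (prod_metric X Y) p (mdist Y) snd"
  by (rule Lipschitz_nearI[where P="\<lambda>_. True" and C=1])
     (simp_all del: mdist_prod_metric add: mdist_prod_components)


subsection \<open>Real functions\<close>

lemma Lipschitz_near_const: "Lipschitz_near X x dist (\<lambda>_. c :: real)"
  by (rule Lipschitz_nearI[where P="\<lambda>_. True" and C=0]) auto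

lemma Lipschitz_near_binary:
  fixes f g :: "'a \<Rightarrow> real"
  assumes f: "Lipschitz_near X x dist f" and g: "Lipschitz_near X x dist g"
    and h: "\<And>a b a' b'. \<bar>h a b - h a' b'\<bar> \<le> \<bar>a - a'\<bar> + \<bar>b - b'\<bar>"
  shows "Lipschitz_near X x dist (\<lambda>u. h (f u) (g u))"
proof -
  obtain C where C: "\<forall>\<^sub>F q in near X x \<times>\<^sub>F near X x.
      dist (f (fst q)) (f (snd q)) \<le> C * mdist X (fst q) (snd q)"
    using f unfolding Lipschitz_near_def by blast
  obtain D where D: "\<forall>\<^sub>F q in near X x \<times>\<^sub>F near X x.
      dist (g (fst q)) (g (snd q)) \<le> D * mdist X (fst q) (snd q)"
    using g unfolding Lipschitz_near_def by blast
  have "\<forall>\<^sub>F q in near X x \<times>\<^sub>F near X x.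
      dist (h (f (fst q)) (g (fst q))) (h (f (snd q)) (g (snd q))) \<le> (C + D) * mdist X (fst q) (snd q)"
    using C D
  proof eventually_elim
    case (elim q)
    with h[of "f (fst q)" "g (fst q)" "f (snd q)" "g (snd q)"]
    show ?case unfolding dist_real_def distrib_right by linarith
  qed
  then show ?thesis unfolding Lipschitz_near_def by blast
qed

lemma Lipschitz_near_add:
  "Lipschitz_near X x dist f \<Longrightarrow> Lipschitz_near X x dist g \<Longrightarrow>
     Lipschitz_near X x dist (\<lambda>u. f u + g u :: real)"
  by (rule Lipschitz_near_binary) auto

lemma Lipschitz_near_diff:
  "Lipschitz_near X x dist f \<Longrightarrow> Lipschitz_near X x dist g \<Longrightarrow>
     Lipschitz_near X x dist (\<lambda>u. f u - g u :: real)"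
  by (rule Lipschitz_near_binary) auto

lemma Lipschitz_near_max:
  "Lipschitz_near X x dist f \<Longrightarrow> Lipschitz_near X x dist g \<Longrightarrow>
     Lipschitz_near X x dist (\<lambda>u. max (f u) (g u) :: real)"
  by (rule Lipschitz_near_binary) auto

lemma Lipschitz_near_min:
  "Lipschitz_near X x dist f \<Longrightarrow> Lipschitz_near X x dist g \<Longrightarrow>
     Lipschitz_near X x dist (\<lambda>u. min (f u) (g u) :: real)"
  by (rule Lipschitz_near_binary) auto

lemma Lipschitz_near_sum:
  assumes "\<And>i. i \<in> I \<Longrightarrow> Lipschitz_near X x dist (f i)"
  shows "Lipschitz_near X x dist (\<lambda>u. \<Sum>i\<in>I. f i u :: real)"
  using assms
  by (induction I rule: infinite_finite_induct)
     (auto intro: Lipschitz_near_const Lipschitz_near_add)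

lemma Lipschitz_near_bounded:
  fixes f :: "'a \<Rightarrow> real"
  assumes "Lipschitz_near X x dist f" "x \<in> mspace X"
  shows "\<forall>\<^sub>F u in near X x. \<bar>f u\<bar> \<le> \<bar>f x\<bar> + 1"
  using Lipschitz_near_continuous[OF assms zero_less_one]
  by eventually_elim (auto simp: dist_real_def)

lemma Lipschitz_near_mult:
  fixes f g :: "'a \<Rightarrow> real"
  assumes f: "Lipschitz_near X x dist f" and g: "Lipschitz_near X x dist g" and x: "x \<in> mspace X"
  shows "Lipschitz_near X x dist (\<lambda>u. f u * g u)"
proof -
  obtain C where C: "C \<ge> 0" "\<forall>\<^sub>F q in near X x \<times>\<^sub>F near X x.
      dist (f (fst q)) (f (snd q)) \<le> C * mdist X (fst q) (snd q)"
    using f by (rule Lipschitz_nearE)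
  obtain D where D: "D \<ge> 0" "\<forall>\<^sub>F q in near X x \<times>\<^sub>F near X x.
      dist (g (fst q)) (g (snd q)) \<le> D * mdist X (fst q) (snd q)"
    using g by (rule Lipschitz_nearE)
  let ?E = "C * (\<bar>g x\<bar> + 1) + (\<bar>f x\<bar> + 1) * D"
  have "\<forall>\<^sub>F q in near X x \<times>\<^sub>F near X x.
      dist (f (fst q) * g (fst q)) (f (snd q) * g (snd q)) \<le> ?E * mdist X (fst q) (snd q)"
    using C(2) D(2) eventually_near_pairs[OF Lipschitz_near_bounded[OF f x]]
      eventually_near_pairs[OF Lipschitz_near_bounded[OF g x]]
  proof eventually_elim
    case (elim q)
    let ?u = "fst q" and ?v = "snd q"
    \<comment> \<open>Change one factor at a time; near \<open>x\<close> the other one is bounded.\<close>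
    have "f ?u * g ?u - f ?v * g ?v = (f ?u - f ?v) * g ?u + f ?v * (g ?u - g ?v)"
      by (simp add: algebra_simps)
    then have "dist (f ?u * g ?u) (f ?v * g ?v) \<le> \<bar>f ?u - f ?v\<bar> * \<bar>g ?u\<bar> + \<bar>f ?v\<bar> * \<bar>g ?u - g ?v\<bar>"
      unfolding dist_real_def by (metis abs_mult abs_triangle_ineq)
    also have "\<dots> \<le> (C * mdist X ?u ?v) * (\<bar>g x\<bar> + 1) + (\<bar>f x\<bar> + 1) * (D * mdist X ?u ?v)"
      using elim C(1) D(1) by (intro add_mono mult_mono) (auto simp: dist_real_def)
    finally show ?case by (simp add: algebra_simps)
  qed
  then show ?thesis unfolding Lipschitz_near_def by blast
qed

lemma Lipschitz_near_inverse:
  fixes f :: "'a \<Rightarrow> real"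
  assumes f: "Lipschitz_near X x dist f" and x: "x \<in> mspace X" and "f x > 0"
  shows "Lipschitz_near X x dist (\<lambda>u. 1 / f u)"
proof -
  obtain C where C: "C \<ge> 0" "\<forall>\<^sub>F q in near X x \<times>\<^sub>F near X x.
      dist (f (fst q)) (f (snd q)) \<le> C * mdist X (fst q) (snd q)"
    using f by (rule Lipschitz_nearE)
  define m where "m = f x / 2"
  have m: "m > 0" using assms by (simp add: m_def)
  have "\<forall>\<^sub>F u in near X x. m \<le> f u"
    using Lipschitz_near_continuous[OF f x m]
    by eventually_elim (simp add: dist_real_def m_def abs_if split: if_splits)
  from C(2) eventually_near_pairs[OF this]
  have "\<forall>\<^sub>F q in near X x \<times>\<^sub>F near X x.
      dist (1 / f (fst q)) (1 / f (snd q)) \<le> (C / (m * m)) * mdist X (fst q) (snd q)"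
  proof eventually_elim
    case (elim q)
    let ?u = "fst q" and ?v = "snd q"
    have "1 / f ?u - 1 / f ?v = (f ?v - f ?u) / (f ?u * f ?v)"
      using elim m by (simp add: field_simps)
    then have "dist (1 / f ?u) (1 / f ?v) = dist (f ?u) (f ?v) / (f ?u * f ?v)"
      using elim m by (simp add: dist_real_def abs_mult abs_minus_commute)
    also have "\<dots> \<le> (C * mdist X ?u ?v) / (m * m)"
      using elim m by (intro frac_le mult_mono) (auto intro: order_trans[OF _ elim(1)])
    finally show ?case by simp
  qed
  then show ?thesis unfolding Lipschitz_near_def by blast
qed

lemma Lipschitz_near_divide:
  fixes f g :: "'a \<Rightarrow> real"
  assumes "Lipschitz_near X x dist f" "Lipschitz_near X x dist g" "x \<in> mspace X" "g x > 0"
  shows "Lipschitz_near X x dist (\<lambda>u. f u / g u)"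
  using Lipschitz_near_mult[OF assms(1) Lipschitz_near_inverse[OF assms(2-4)] assms(3)] by simp


section \<open>Vectors of finite support and the points of a realization\<close>

abbreviation supp :: "('j \<Rightarrow> real) \<Rightarrow> 'j set" where
  "supp z \<equiv> {j. z j \<noteq> 0}"

text \<open>Local finiteness of the support is part of the notion: together with coordinatewise estimates it
  gives a single Lipschitz constant for all coordinates.\<close>

definition Lipschitz_vector_near :: "'a metric \<Rightarrow> 'a \<Rightarrow> ('a \<Rightarrow> 'j \<Rightarrow> real) \<Rightarrow> bool" where
  "Lipschitz_vector_near X x z \<longleftrightarrow>
     (\<exists>W. finite W \<and> (\<forall>\<^sub>F u in near X x. supp (z u) \<subseteq> W)) \<and>
     (\<forall>j. Lipschitz_near X x dist (\<lambda>u. z u j))"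

lemma Lipschitz_vector_nearI:
  assumes "finite W" "\<forall>\<^sub>F u in near X x. supp (z u) \<subseteq> W"
    "\<And>j. Lipschitz_near X x dist (\<lambda>u. z u j)"
  shows "Lipschitz_vector_near X x z"
  using assms unfolding Lipschitz_vector_near_def by blast

lemma Lipschitz_vector_nearE:
  assumes "Lipschitz_vector_near X x z"
  obtains C W where "0 \<le> C" "finite W" "\<forall>\<^sub>F u in near X x. supp (z u) \<subseteq> W"
    "\<forall>\<^sub>F q in near X x \<times>\<^sub>F near X x.
       \<forall>j. \<bar>z (fst q) j - z (snd q) j\<bar> \<le> C * mdist X (fst q) (snd q)"
proof -
  obtain W where W: "finite W" "\<forall>\<^sub>F u in near X x. supp (z u) \<subseteq> W"
    using assms unfolding Lipschitz_vector_near_def by blast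
  have "\<exists>C. 0 \<le> C \<and> (\<forall>\<^sub>F q in near X x \<times>\<^sub>F near X x.
      \<bar>z (fst q) j - z (snd q) j\<bar> \<le> C * mdist X (fst q) (snd q))" for j
  proof -
    have "Lipschitz_near X x dist (\<lambda>u. z u j)"
      using assms unfolding Lipschitz_vector_near_def by blast
    then show ?thesis
      by (rule Lipschitz_nearE) (auto simp: dist_real_def)
  qed
  then have "\<exists>C. \<forall>j. 0 \<le> C j \<and> (\<forall>\<^sub>F q in near X x \<times>\<^sub>F near X x.
      \<bar>z (fst q) j - z (snd q) j\<bar> \<le> C j * mdist X (fst q) (snd q))"
    by (intro choice allI)
  then obtain C where C: "\<And>j. 0 \<le> C j" "\<And>j. \<forall>\<^sub>F q in near X x \<times>\<^sub>F near X x.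
      \<bar>z (fst q) j - z (snd q) j\<bar> \<le> C j * mdist X (fst q) (snd q)"
    by blast
  have "\<forall>\<^sub>F q in near X x \<times>\<^sub>F near X x. \<forall>j\<in>W.
      \<bar>z (fst q) j - z (snd q) j\<bar> \<le> C j * mdist X (fst q) (snd q)"
    using W(1) C(2) by (intro eventually_ball_finite) auto
  with eventually_near_pairs[OF W(2)]
  have "\<forall>\<^sub>F q in near X x \<times>\<^sub>F near X x. \<forall>j.
      \<bar>z (fst q) j - z (snd q) j\<bar> \<le> sum C W * mdist X (fst q) (snd q)"
  proof eventually_elim
    case (elim q)
    show ?case
    proof
      fix j
      show "\<bar>z (fst q) j - z (snd q) j\<bar> \<le> sum C W * mdist X (fst q) (snd q)"
      proof (cases "j \<in> W")
        case True
        then have "\<bar>z (fst q) j - z (snd q) j\<bar> \<le> C j * mdist X (fst q) (snd q)"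
          using elim by blast
        also have "\<dots> \<le> sum C W * mdist X (fst q) (snd q)"
          using True W(1) C(1) by (intro mult_right_mono member_le_sum) auto
        finally show ?thesis .
      next
        case False
        then have "z (fst q) j = 0" "z (snd q) j = 0" using elim by auto
        then show ?thesis by (simp add: sum_nonneg C(1))
      qed
    qed
  qed
  with W C(1) show thesis
    by (intro that[of "sum C W" W]) (auto simp: sum_nonneg)
qed

lemma Lipschitz_vector_near_coordinate:
  "Lipschitz_vector_near X x z \<Longrightarrow> Lipschitz_near X x dist (\<lambda>u. z u j)"
  unfolding Lipschitz_vector_near_def by blast

lemma Lipschitz_vector_near_add:
  assumes v: "Lipschitz_vector_near X x v" and w: "Lipschitz_vector_near X x w"
  shows "Lipschitz_vector_near X x (\<lambda>u j. v u j + w u j)"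
proof -
  obtain V where V: "finite V" "\<forall>\<^sub>F u in near X x. supp (v u) \<subseteq> V"
    using v unfolding Lipschitz_vector_near_def by blast
  obtain W where W: "finite W" "\<forall>\<^sub>F u in near X x. supp (w u) \<subseteq> W"
    using w unfolding Lipschitz_vector_near_def by blast
  show ?thesis
  proof (rule Lipschitz_vector_nearI)
    show "finite (V \<union> W)" using V W by simp
    show "\<forall>\<^sub>F u in near X x. supp (\<lambda>j. v u j + w u j) \<subseteq> V \<union> W"
      using V(2) W(2)
    proof eventually_elim
      case (elim u)
      have "supp (\<lambda>j. v u j + w u j) \<subseteq> supp (v u) \<union> supp (w u)" by auto
      also have "\<dots> \<subseteq> V \<union> W" using elim by (rule Un_mono)
      finally show ?case .
    qed
    show "Lipschitz_near X x dist (\<lambda>u. v u j + w u j)" for j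
      using v w by (rule Lipschitz_near_add[OF Lipschitz_vector_near_coordinate
          Lipschitz_vector_near_coordinate])
  qed
qed

lemma Lipschitz_vector_near_scale:
  assumes z: "Lipschitz_vector_near X x z" and r: "Lipschitz_near X x dist r" and x: "x \<in> mspace X"
  shows "Lipschitz_vector_near X x (\<lambda>u j. r u * z u j)"
proof -
  obtain W where W: "finite W" "\<forall>\<^sub>F u in near X x. supp (z u) \<subseteq> W"
    using z unfolding Lipschitz_vector_near_def by blast
  have "\<forall>\<^sub>F u in near X x. supp (\<lambda>j. r u * z u j) \<subseteq> W"
    using W(2) by eventually_elim auto
  then show ?thesis
    by (rule Lipschitz_vector_nearI[OF W(1)])
       (rule Lipschitz_near_mult[OF r Lipschitz_vector_near_coordinate[OF z] x])
qed

lemma Lipschitz_vector_near_compose: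
  assumes f: "Lipschitz_near X x (mdist Y) f" "x \<in> mspace X" "f \<in> mspace X \<rightarrow> mspace Y"
    and z: "Lipschitz_vector_near Y (f x) z"
  shows "Lipschitz_vector_near X x (\<lambda>u. z (f u))"
proof -
  obtain W where W: "finite W" "\<forall>\<^sub>F y in near Y (f x). supp (z y) \<subseteq> W"
    using z unfolding Lipschitz_vector_near_def by blast
  have "\<forall>\<^sub>F u in near X x. supp (z (f u)) \<subseteq> W"
    by (rule filterlim_near[OF f, unfolded filterlim_iff, rule_format, OF W(2)])
  then show ?thesis
    by (rule Lipschitz_vector_nearI[OF W(1)])
       (rule Lipschitz_near_compose[OF f Lipschitz_vector_near_coordinate[OF z]])
qed

text \<open>Used for the greatest coordinate of a vector and for the gap of a simplex, which are Lipschitz in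
  the maximum norm.\<close>

lemma Lipschitz_near_vector_function:
  fixes \<Phi> :: "('j \<Rightarrow> real) \<Rightarrow> real"
  assumes z: "Lipschitz_vector_near X x z"
    and \<Phi>: "\<And>v w \<delta>. finite (supp v) \<Longrightarrow> finite (supp w) \<Longrightarrow> (\<And>j. \<bar>v j - w j\<bar> \<le> \<delta>) \<Longrightarrow>
              \<bar>\<Phi> v - \<Phi> w\<bar> \<le> K * \<delta>"
  shows "Lipschitz_near X x dist (\<lambda>u. \<Phi> (z u))"
proof -
  obtain C W where CW: "finite W" "\<forall>\<^sub>F u in near X x. supp (z u) \<subseteq> W"
    "\<forall>\<^sub>F q in near X x \<times>\<^sub>F near X x.
       \<forall>j. \<bar>z (fst q) j - z (snd q) j\<bar> \<le> C * mdist X (fst q) (snd q)"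
    using z by (rule Lipschitz_vector_nearE)
  have "\<forall>\<^sub>F q in near X x \<times>\<^sub>F near X x.
      dist (\<Phi> (z (fst q))) (\<Phi> (z (snd q))) \<le> (K * C) * mdist X (fst q) (snd q)"
    using CW(3) eventually_near_pairs[OF CW(2)]
  proof eventually_elim
    case (elim q)
    then have "finite (supp (z (fst q)))" "finite (supp (z (snd q)))"
      using CW(1) finite_subset by blast+
    with \<Phi> elim show ?case by (simp add: dist_real_def mult.assoc)
  qed
  then show ?thesis unfolding Lipschitz_near_def by blast
qed

lemma finite_image_of_finite_supp: "finite (supp z) \<Longrightarrow> finite (z ` A)"
  for z :: "'j \<Rightarrow> real"
  by (rule finite_subset[of _ "insert 0 (z ` supp z)"]) auto

lemma Max_insert_image_diff:
  fixes v w :: "'j \<Rightarrow> real"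
  assumes "finite (supp v)" "finite (supp w)" "\<And>j. \<bar>v j - w j\<bar> \<le> \<delta>"
  shows "\<bar>Max (insert 0 (v ` A)) - Max (insert 0 (w ` A))\<bar> \<le> \<delta>"
proof -
  have \<delta>: "0 \<le> \<delta>" using assms(3) abs_ge_zero order_trans by blast
  have le: "Max (insert 0 (v ` A)) \<le> Max (insert 0 (w ` A)) + \<delta>"
    if fin: "finite (supp v)" "finite (supp w)" and "\<And>j. \<bar>v j - w j\<bar> \<le> \<delta>" for v w :: "'j \<Rightarrow> real"
  proof -
    have fw: "finite (insert 0 (w ` A))" using finite_image_of_finite_supp[OF fin(2)] by simp
    have "v j \<le> Max (insert 0 (w ` A)) + \<delta>" if "j \<in> A" for j
      using Max_ge[OF fw, of "w j"] that \<open>\<bar>v j - w j\<bar> \<le> \<delta>\<close> by auto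
    moreover have "0 \<le> Max (insert 0 (w ` A)) + \<delta>"
      using Max_ge[OF fw, of 0] \<delta> by simp
    ultimately show ?thesis
      using finite_image_of_finite_supp[OF fin(1)] by (subst Max_le_iff) auto
  qed
  show ?thesis
    using le[of v w] le[of w v] assms by (simp add: abs_le_iff abs_minus_commute)
qed

text \<open>The greatest coordinate, unless all coordinates are negative. The inserted \<open>0\<close> gives it the form
  of the maximum outside a simplex below, with the same Lipschitz estimate.\<close>

definition peak :: "('j \<Rightarrow> real) \<Rightarrow> real" where
  "peak z = Max (insert 0 (range z))"

lemma peak_ge: "finite (supp z) \<Longrightarrow> z j \<le> peak z"
  unfolding peak_def by (rule Max_ge) (auto simp: finite_image_of_finite_supp)

lemma peak_pos: "finite (supp z) \<Longrightarrow> (\<And>j. 0 \<le> z j) \<Longrightarrow> supp z \<noteq> {} \<Longrightarrow> 0 < peak z"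
proof -
  assume "finite (supp z)" "\<And>j. 0 \<le> z j" "supp z \<noteq> {}"
  then obtain j where "0 < z j" by (auto simp: less_le)
  with peak_ge[OF \<open>finite (supp z)\<close>, of j] show ?thesis by linarith
qed

lemma peak_attained:
  assumes "finite (supp z)" "0 < peak z"
  obtains j where "z j = peak z"
proof -
  have "peak z \<in> insert 0 (range z)"
    unfolding peak_def by (rule Max_in) (auto simp: finite_image_of_finite_supp[OF assms(1)])
  with assms(2) that show thesis by auto
qed

lemma peak_scale:
  assumes "finite (supp z)" "0 < c"
  shows "peak (\<lambda>j. c * z j) = c * peak z"
proof -
  have "mono (\<lambda>r. c * r)" using \<open>0 < c\<close> by (auto intro!: monoI mult_left_mono)
  from mono_Max_commute[OF this, of "insert 0 (range z)"]
  show ?thesis unfolding peak_def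
    by (simp add: finite_image_of_finite_supp[OF assms(1)] image_image)
qed

lemma Lipschitz_near_peak:
  "Lipschitz_vector_near X x z \<Longrightarrow> Lipschitz_near X x dist (\<lambda>u. peak (z u))"
  unfolding peak_def
  by (rule Lipschitz_near_vector_function[where K=1]) (auto intro: Max_insert_image_diff)

text \<open>Cutting off at half the greatest coordinate and rescaling to maximum \<open>1\<close>: all coordinates of at
  least half the maximum become maximal.\<close>

definition cap :: "('j \<Rightarrow> real) \<Rightarrow> 'j \<Rightarrow> real" where
  "cap z = (\<lambda>j. min 1 (2 * z j / peak z))"

lemma cap_scale: "finite (supp z) \<Longrightarrow> 0 < c \<Longrightarrow> cap (\<lambda>j. c * z j) = cap z"
  by (simp add: cap_def peak_scale fun_eq_iff)

lemma supp_cap: "0 < peak z \<Longrightarrow> supp (cap z) = supp z"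
  by (auto simp: cap_def min_def)

lemma cap_le_1: "cap z j \<le> 1"
  by (simp add: cap_def)

lemma cap_eq_1_iff: "0 < peak z \<Longrightarrow> cap z j = 1 \<longleftrightarrow> peak z \<le> 2 * z j"
  by (simp add: cap_def min_def pos_divide_le_eq pos_le_divide_eq)

lemma Lipschitz_vector_near_cap:
  assumes z: "Lipschitz_vector_near X x z" and x: "x \<in> mspace X" and "0 < peak (z x)"
  shows "Lipschitz_vector_near X x (\<lambda>u. cap (z u))"
proof -
  obtain W where W: "finite W" "\<forall>\<^sub>F u in near X x. supp (z u) \<subseteq> W"
    using z unfolding Lipschitz_vector_near_def by blast
  have "\<forall>\<^sub>F u in near X x. supp (cap (z u)) \<subseteq> W"
    using W(2) by eventually_elim (auto simp: cap_def)
  moreover have "Lipschitz_near X x dist (\<lambda>u. cap (z u) j)" for j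
    unfolding cap_def
    by (intro Lipschitz_near_min Lipschitz_near_divide Lipschitz_near_mult Lipschitz_near_const
        Lipschitz_near_peak Lipschitz_vector_near_coordinate z x assms(3))
  ultimately show ?thesis
    using W(1) by (intro Lipschitz_vector_nearI)
qed


subsection \<open>Normalising a vector to a point of the realization\<close>

definition realise :: "('j \<Rightarrow> real) \<Rightarrow> 'j \<Rightarrow>\<^sub>0 real" where
  "realise v = Abs_poly_mapping (\<lambda>j. v j / sum v (supp v))"

lemma lookup_realise:
  assumes "finite (supp v)"
  shows "Poly_Mapping.lookup (realise v) j = v j / sum v (supp v)"
proof -
  have "finite {j. v j / sum v (supp v) \<noteq> 0}"
    by (rule finite_subset[OF _ assms]) auto
  then show ?thesis unfolding realise_def by (simp add: Abs_poly_mapping_inverse)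
qed

lemma lookup_sum_single:
  assumes "finite s"
  shows "Poly_Mapping.lookup (\<Sum>j\<in>s. Poly_Mapping.single j (t j)) k = (if k \<in> s then t k else 0 :: real)"
  using assms by (simp add: lookup_sum lookup_single when_def sum.delta)

text \<open>Since faces of simplices are simplices, a point of the realization lies in the simplex spanned by
  its support.\<close>

lemma mspace_geometric_realization_iff:
  assumes fin: "\<And>s. s \<in> K \<Longrightarrow> finite s"
    and sub: "\<And>s t. s \<in> K \<Longrightarrow> t \<subseteq> s \<Longrightarrow> t \<noteq> {} \<Longrightarrow> t \<in> K"
  shows "y \<in> mspace (geometric_realization K) \<longleftrightarrow>
     (\<forall>j. 0 \<le> Poly_Mapping.lookup y j) \<and> Poly_Mapping.keys y \<in> K \<and>
     sum (Poly_Mapping.lookup y) (Poly_Mapping.keys y) = 1"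
    (is "_ \<longleftrightarrow> ?P y")
proof
  assume "y \<in> mspace (geometric_realization K)"
  then obtain s t where s: "s \<in> K" and t: "\<forall>j\<in>s. 0 \<le> t j" "sum t s = 1"
    and y: "y = (\<Sum>j\<in>s. Poly_Mapping.single j (t j))"
    unfolding geometric_realization_def realized_simplex_def by auto
  have lk: "Poly_Mapping.lookup y k = (if k \<in> s then t k else 0)" for k
    unfolding y by (rule lookup_sum_single[OF fin[OF s]])
  have keys: "Poly_Mapping.keys y \<subseteq> s"
    by (auto simp: in_keys_iff lk split: if_splits)
  have "sum (Poly_Mapping.lookup y) (Poly_Mapping.keys y) = sum (Poly_Mapping.lookup y) s"
    by (rule sum.mono_neutral_left[OF fin[OF s] keys]) (auto simp: in_keys_iff)
  then have one: "sum (Poly_Mapping.lookup y) (Poly_Mapping.keys y) = 1"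
    using t(2) by (simp add: lk)
  then have "Poly_Mapping.keys y \<noteq> {}" by auto
  with one keys sub[OF s] t(1) show "?P y" by (auto simp: lk)
next
  assume y: "?P y"
  have "y = (\<Sum>j\<in>Poly_Mapping.keys y. Poly_Mapping.single j (Poly_Mapping.lookup y j))"
    by (rule poly_mapping_eqI) (simp add: lookup_sum_single in_keys_iff)
  with y have "y \<in> realized_simplex (Poly_Mapping.keys y)"
    unfolding realized_simplex_def by blast
  with y show "y \<in> mspace (geometric_realization K)"
    unfolding geometric_realization_def by auto
qed

lemma realise_lookup:
  assumes "sum (Poly_Mapping.lookup y) (Poly_Mapping.keys y) = 1"
  shows "realise (Poly_Mapping.lookup y) = y"
proof (rule poly_mapping_eqI)
  fix j
  have "supp (Poly_Mapping.lookup y) = Poly_Mapping.keys y"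
    by (auto simp: in_keys_iff)
  with assms show "Poly_Mapping.lookup (realise (Poly_Mapping.lookup y)) j = Poly_Mapping.lookup y j"
    by (simp add: lookup_realise)
qed

lemma realise_properties:
  assumes fin: "finite (supp v)" and nn: "\<And>j. 0 \<le> v j" and ne: "supp v \<noteq> {}"
  shows "0 < sum v (supp v)" "Poly_Mapping.keys (realise v) = supp v"
    "0 \<le> Poly_Mapping.lookup (realise v) j"
    "sum (Poly_Mapping.lookup (realise v)) (Poly_Mapping.keys (realise v)) = 1"
proof -
  show pos: "0 < sum v (supp v)"
    using fin ne nn by (intro sum_pos) (auto simp: less_le)
  then show keys: "Poly_Mapping.keys (realise v) = supp v"
    by (auto simp: in_keys_iff lookup_realise[OF fin])
  show "0 \<le> Poly_Mapping.lookup (realise v) j"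
    using pos nn by (simp add: lookup_realise[OF fin])
  have "sum (Poly_Mapping.lookup (realise v)) (supp v) = sum v (supp v) / sum v (supp v)"
    unfolding sum_divide_distrib by (intro sum.cong refl lookup_realise[OF fin])
  with pos keys show "sum (Poly_Mapping.lookup (realise v)) (Poly_Mapping.keys (realise v)) = 1"
    by simp
qed

text \<open>The only way in which maps into the realization are constructed below. Near a point the
  normalising total runs over a fixed finite set and stays away from \<open>0\<close>.\<close>

lemma locally_Lipschitz_realise:
  assumes fin: "\<And>s. s \<in> K \<Longrightarrow> finite s"
    and sub: "\<And>s t. s \<in> K \<Longrightarrow> t \<subseteq> s \<Longrightarrow> t \<noteq> {} \<Longrightarrow> t \<in> K" and ne: "{} \<notin> K"
    and v: "\<And>x. x \<in> mspace X \<Longrightarrow> supp (v x) \<in> K" "\<And>x j. x \<in> mspace X \<Longrightarrow> 0 \<le> v x j"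
    and lip: "\<And>x. x \<in> mspace X \<Longrightarrow> Lipschitz_vector_near X x v"
  shows "locally_Lipschitz_map X (geometric_realization K) (\<lambda>x. realise (v x))"
  unfolding locally_Lipschitz_map_iff
proof (intro conjI ballI Pi_I)
  note props = realise_properties[OF fin[OF v(1)] v(2)]
  have ne': "supp (v x) \<noteq> {}" if "x \<in> mspace X" for x
    using v(1)[OF that] ne by metis
  fix x assume x: "x \<in> mspace X"
  show "realise (v x) \<in> mspace (geometric_realization K)"
    using props[OF x x ne'[OF x]] v(1)[OF x]
    by (subst mspace_geometric_realization_iff[OF fin sub]) auto
  obtain C W where CW: "finite W" "\<forall>\<^sub>F u in near X x. supp (v u) \<subseteq> W"
    using lip[OF x] by (rule Lipschitz_vector_nearE)
  have total: "sum (v u) (supp (v u)) = sum (v u) W" if "supp (v u) \<subseteq> W" for u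
    using that CW(1) by (intro sum.mono_neutral_left) auto
  have "supp (v x) \<subseteq> W"
    using CW(2) x unfolding eventually_nhdsin by auto
  with props(1)[OF x x ne'[OF x]] have "0 < sum (v x) W"
    by (simp add: total)
  then have quot: "Lipschitz_near X x dist (\<lambda>u. v u j / sum (v u) W)" for j
    by (intro Lipschitz_near_divide Lipschitz_near_sum Lipschitz_vector_near_coordinate lip x)
  have "Lipschitz_vector_near X x (\<lambda>u. Poly_Mapping.lookup (realise (v u)))"
  proof (rule Lipschitz_vector_nearI[OF CW(1)])
    show "\<forall>\<^sub>F u in near X x. supp (Poly_Mapping.lookup (realise (v u))) \<subseteq> W"
      using CW(2)
    proof eventually_elim
      case (elim u)
      then have "finite (supp (v u))" using CW(1) finite_subset by blast
      from lookup_realise[OF this] show ?case using elim by auto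
    qed
    show "Lipschitz_near X x dist (\<lambda>u. Poly_Mapping.lookup (realise (v u)) j)" for j
    proof (rule Lipschitz_near_cong[OF quot[of j]])
      show "\<forall>\<^sub>F u in near X x. Poly_Mapping.lookup (realise (v u)) j = v u j / sum (v u) W"
        using CW(2)
      proof eventually_elim
        case (elim u)
        then have "finite (supp (v u))" using CW(1) finite_subset by blast
        from lookup_realise[OF this, of j] total[OF elim] show ?case by simp
      qed
    qed
  qed
  then obtain C where "\<forall>\<^sub>F q in near X x \<times>\<^sub>F near X x. \<forall>j.
      \<bar>Poly_Mapping.lookup (realise (v (fst q))) j - Poly_Mapping.lookup (realise (v (snd q))) j\<bar>
        \<le> C * mdist X (fst q) (snd q)"
    by (rule Lipschitz_vector_nearE)
  then show "Lipschitz_near X x (mdist (geometric_realization K)) (\<lambda>x. realise (v x))"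
    unfolding Lipschitz_near_def geometric_realization_def
    by (auto simp: max_dist_le_iff)
qed

lemma nerve_closed:
  "s \<in> nerve J U \<Longrightarrow> finite s"
  "s \<in> nerve J U \<Longrightarrow> t \<subseteq> s \<Longrightarrow> t \<noteq> {} \<Longrightarrow> t \<in> nerve J U"
  "{} \<notin> nerve J U"
proof -
  show "s \<in> nerve J U \<Longrightarrow> t \<subseteq> s \<Longrightarrow> t \<noteq> {} \<Longrightarrow> t \<in> nerve J U"
    using INF_superset_mono[of t s U U] unfolding nerve_def by (auto dest: finite_subset)
qed (auto simp: nerve_def)

text \<open>If \<open>j\<close> is a vertex with positive coordinate at \<open>y\<close>, it stays positive near \<open>y\<close>, so nearby points
  are supported in the star of \<open>j\<close>, which is finite.\<close>

lemma Lipschitz_vector_near_lookup: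
  assumes star: "\<And>j. j \<in> J \<Longrightarrow> finite {k\<in>J. U j \<inter> U k \<noteq> {}}"
    and y: "y \<in> mspace (geometric_realization (nerve J U))"
  shows "Lipschitz_vector_near (geometric_realization (nerve J U)) y Poly_Mapping.lookup"
proof -
  let ?K = "geometric_realization (nerve J U)"
  have dist: "\<bar>Poly_Mapping.lookup u j - Poly_Mapping.lookup w j\<bar> \<le> mdist ?K u w" for u w j
    by (simp add: geometric_realization_def abs_diff_le_max_dist)
  have lip: "Lipschitz_near ?K y dist (\<lambda>u. Poly_Mapping.lookup u j)" for j
    by (rule Lipschitz_nearI[where P="\<lambda>_. True" and C=1])
       (use dist in \<open>auto simp: dist_real_def\<close>)
  have keys: "Poly_Mapping.keys y \<in> nerve J U"
    using y by (simp add: mspace_geometric_realization_iff[OF nerve_closed(1,2)])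
  then obtain j where j: "j \<in> Poly_Mapping.keys y" "j \<in> J"
    unfolding nerve_def by blast
  have "0 < Poly_Mapping.lookup y j"
    using y j(1) by (simp add: mspace_geometric_realization_iff[OF nerve_closed(1,2)] in_keys_iff less_le)
  from Lipschitz_near_continuous[OF lip y this, of j] eventually_near_mspace[of ?K y]
  have "\<forall>\<^sub>F u in near ?K y. supp (Poly_Mapping.lookup u) \<subseteq> {k\<in>J. U j \<inter> U k \<noteq> {}}"
  proof eventually_elim
    case (elim u)
    then have "j \<in> Poly_Mapping.keys u" "Poly_Mapping.keys u \<in> nerve J U"
      by (auto simp: dist_real_def in_keys_iff mspace_geometric_realization_iff[OF nerve_closed(1,2)])
    moreover have "supp (Poly_Mapping.lookup u) = Poly_Mapping.keys u"
      by (auto simp: in_keys_iff)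
    ultimately show ?case
      unfolding nerve_def by blast
  qed
  with star[OF j(2)] lip show ?thesis by (intro Lipschitz_vector_nearI)
qed


section \<open>Superlevel sets of a vector and the size of their gaps\<close>

text \<open>Positive exactly if \<open>\<sigma>\<close> is the superlevel set \<open>{j. r < z j}\<close> of some \<open>r \<ge> 0\<close>, for \<open>z\<close> of
  finite support and finite nonempty \<open>\<sigma>\<close>; the inserted \<open>0\<close> excludes \<open>r < 0\<close>.\<close>

definition gap :: "'j set \<Rightarrow> ('j \<Rightarrow> real) \<Rightarrow> real" where
  "gap \<sigma> z = Min (z ` \<sigma>) - Max (insert 0 (z ` (- \<sigma>)))"

text \<open>The factor is chosen so that a vector with greatest coordinate \<open>1\<close> has a simplex of weight \<open>1\<close>.
  It depends only on the number of vertices of \<open>\<sigma>\<close>, so one choice serves nerves of unbounded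
  dimension as well.\<close>

definition weight :: "'j set \<Rightarrow> ('j \<Rightarrow> real) \<Rightarrow> real" where
  "weight \<sigma> z = max 0 (min 1 (2 ^ (card \<sigma> + 1) * gap \<sigma> z))"

definition active :: "'j set \<Rightarrow> ('j \<Rightarrow> real) \<Rightarrow> bool" where
  "active \<sigma> z \<longleftrightarrow> finite \<sigma> \<and> \<sigma> \<noteq> {} \<and> 0 < weight \<sigma> z"

lemma weight_bounds [simp]: "0 \<le> weight \<sigma> z" "weight \<sigma> z \<le> 1"
  by (auto simp: weight_def)

lemma weight_pos_iff: "0 < weight \<sigma> z \<longleftrightarrow> 0 < gap \<sigma> z"
  by (auto simp: weight_def less_max_iff_disj zero_less_mult_iff)

lemma Min_image_diff:
  fixes v w :: "'j \<Rightarrow> real"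
  assumes "finite \<sigma>" "\<sigma> \<noteq> {}" "\<And>j. \<bar>v j - w j\<bar> \<le> \<delta>"
  shows "\<bar>Min (v ` \<sigma>) - Min (w ` \<sigma>)\<bar> \<le> \<delta>"
proof -
  have le: "Min (v ` \<sigma>) - \<delta> \<le> Min (w ` \<sigma>)" if "\<And>j. \<bar>v j - w j\<bar> \<le> \<delta>" for v w :: "'j \<Rightarrow> real"
  proof -
    have "Min (v ` \<sigma>) - \<delta> \<le> w j" if "j \<in> \<sigma>" for j
    proof -
      have "Min (v ` \<sigma>) \<le> v j" using that assms(1) by (intro Min_le) auto
      with \<open>\<bar>v j - w j\<bar> \<le> \<delta>\<close> show ?thesis by linarith
    qed
    then show ?thesis using assms by (subst Min_ge_iff) auto
  qed
  show ?thesis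
    using le[of v w] le[of w v] assms(3) by (simp add: abs_le_iff abs_minus_commute)
qed

lemma gap_diff:
  assumes "finite \<sigma>" "\<sigma> \<noteq> {}" "finite (supp v)" "finite (supp w)" "\<And>j. \<bar>v j - w j\<bar> \<le> \<delta>"
  shows "\<bar>gap \<sigma> v - gap \<sigma> w\<bar> \<le> 2 * \<delta>"
proof -
  have "\<bar>Min (v ` \<sigma>) - Min (w ` \<sigma>)\<bar> \<le> \<delta>"
    using assms(5) by (rule Min_image_diff[OF assms(1,2)])
  moreover have "\<bar>Max (insert 0 (v ` (- \<sigma>))) - Max (insert 0 (w ` (- \<sigma>)))\<bar> \<le> \<delta>"
    using assms(5) by (rule Max_insert_image_diff[OF assms(3,4)])
  ultimately show ?thesis unfolding gap_def by linarith
qed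

lemma weight_diff:
  assumes "finite \<sigma>" "\<sigma> \<noteq> {}" "finite (supp v)" "finite (supp w)" "\<And>j. \<bar>v j - w j\<bar> \<le> \<delta>"
  shows "\<bar>weight \<sigma> v - weight \<sigma> w\<bar> \<le> 2 ^ (card \<sigma> + 2) * \<delta>"
proof -
  have clamp: "\<bar>max 0 (min 1 a) - max 0 (min 1 b)\<bar> \<le> \<bar>a - b\<bar>" for a b :: real by auto
  have "\<bar>weight \<sigma> v - weight \<sigma> w\<bar> \<le> 2 ^ (card \<sigma> + 1) * \<bar>gap \<sigma> v - gap \<sigma> w\<bar>"
    unfolding weight_def
    using clamp[of "2 ^ (card \<sigma> + 1) * gap \<sigma> v" "2 ^ (card \<sigma> + 1) * gap \<sigma> w"]
    by (simp add: abs_mult flip: right_diff_distrib)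
  also have "\<dots> \<le> 2 ^ (card \<sigma> + 1) * (2 * \<delta>)"
    using gap_diff[OF assms] by (intro mult_left_mono) auto
  finally show ?thesis by simp
qed

lemma active_superlevel:
  assumes "active \<sigma> z" "finite (supp z)" "j \<in> \<sigma>"
  shows "0 < z j" "k \<notin> \<sigma> \<Longrightarrow> z k < z j"
proof -
  have "0 < gap \<sigma> z" "finite \<sigma>"
    using assms(1) by (auto simp: active_def weight_pos_iff)
  then have less: "Max (insert 0 (z ` (- \<sigma>))) < z j"
    using order_less_le_trans[OF _ Min_le[of "z ` \<sigma>" "z j"]] assms(3) unfolding gap_def by simp
  have fin: "finite (insert 0 (z ` (- \<sigma>)))"
    using finite_image_of_finite_supp[OF assms(2)] by simp
  from less Max_ge[OF fin, of 0] show "0 < z j" by simp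
  show "z k < z j" if "k \<notin> \<sigma>"
    using less Max_ge[OF fin, of "z k"] that by simp
qed

lemma active_subset_supp: "active \<sigma> z \<Longrightarrow> finite (supp z) \<Longrightarrow> \<sigma> \<subseteq> supp z"
  using active_superlevel(1) by fastforce

lemma active_contains_maximal:
  assumes "active \<sigma> z" "finite (supp z)" "\<And>k. z k \<le> z j"
  shows "j \<in> \<sigma>"
proof -
  obtain i where "i \<in> \<sigma>" using assms(1) by (auto simp: active_def)
  with active_superlevel(2)[OF assms(1,2) this, of j] assms(3)[of i] show ?thesis by force
qed

text \<open>Two superlevel sets of one vector are nested. In particular at most one active set has a given
  number of elements.\<close>

lemma active_chain:
  assumes "active \<sigma> z" "active \<tau> z" "finite (supp z)" "card \<sigma> \<le> card \<tau>"
  shows "\<sigma> \<subseteq> \<tau>"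
proof
  fix j assume j: "j \<in> \<sigma>"
  show "j \<in> \<tau>"
  proof (rule ccontr)
    assume "j \<notin> \<tau>"
    have "k \<in> \<sigma>" if "k \<in> \<tau>" for k
      using active_superlevel(2)[OF assms(2,3) that \<open>j \<notin> \<tau>\<close>]
        active_superlevel(2)[OF assms(1,3) j, of k] by force
    with j \<open>j \<notin> \<tau>\<close> have "\<tau> \<subset> \<sigma>" by blast
    then have "card \<tau> < card \<sigma>"
      using assms(1) psubset_card_mono unfolding active_def by blast
    with assms(4) show False by simp
  qed
qed

text \<open>Compare the superlevel sets \<open>A n\<close> at the decreasing levels \<open>r n = (1/2) ^ (n + 1)\<close>. For the
  least \<open>n\<close> with \<open>card (A n) \<le> n\<close>, the set \<open>A (n - 1)\<close> already has at least \<open>n\<close> elements, so the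
  two sets coincide, have \<open>n\<close> elements, and no coordinate lies in the band between the levels,
  whose width is \<open>(1/2) ^ (n + 1)\<close>.\<close>

lemma exists_large_gap:
  assumes fin: "finite (supp z)" and top: "z i = 1"
  obtains \<sigma> where "finite \<sigma>" "\<sigma> \<noteq> {}" "1 < 2 ^ (card \<sigma> + 1) * gap \<sigma> z"
proof -
  define r :: "nat \<Rightarrow> real" where "r n = (1/2) ^ (n + 1)" for n
  define A where "A n = {j. r n < z j}" for n
  have r_pos: "0 < r n" for n by (simp add: r_def)
  have A: "A n \<subseteq> supp z" for n
  proof
    fix j assume "j \<in> A n"
    then show "j \<in> supp z" using r_pos[of n] by (simp add: A_def)
  qed
  have finA: "finite (A n)" for n using A fin by (rule finite_subset)
  have iA: "i \<in> A n" for n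
  proof -
    have "r n \<le> 1/2" unfolding r_def by (simp add: power_le_one)
    then show ?thesis by (simp add: A_def top)
  qed
  have card_pos: "0 < card (A n)" for n using finA iA by (auto simp: card_gt_0_iff)
  have ex: "card (A (card (supp z))) \<le> card (supp z)" using A fin by (simp add: card_mono)
  define n where "n = (LEAST n. card (A n) \<le> n)"
  have n: "card (A n) \<le> n" unfolding n_def using ex by (rule LeastI)
  \<comment> \<open>\<open>A 0\<close> contains \<open>i\<close>, so \<open>n\<close> is not \<open>0\<close>.\<close>
  with card_pos[of n] obtain m where m: "n = Suc m" by (cases n) auto
  have "\<not> card (A m) \<le> m"
    using not_less_Least[of m "\<lambda>n. card (A n) \<le> n"] m by (auto simp: n_def)
  then have "card (A n) \<le> card (A m)" using n m by simp
  moreover have "r n \<le> r m" unfolding r_def m by (intro power_decreasing) auto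
  then have "A m \<subseteq> A n" by (auto simp: A_def)
  ultimately have eq: "A m = A n" using finA by (intro card_seteq) auto
  with \<open>\<not> card (A m) \<le> m\<close> n m have card: "card (A n) = n" by simp
  have "r m < Min (z ` A m)"
    using finA[of m] iA[of m] by (subst Min_gr_iff) (auto simp: A_def)
  then have "r m < Min (z ` A n)" by (simp only: eq)
  moreover have "Max (insert 0 (z ` (- A n))) \<le> r n"
    using finite_image_of_finite_supp[OF fin, of "- A n"] r_pos[of n]
    by (subst Max_le_iff) (auto simp: A_def)
  ultimately have "r m - r n < gap (A n) z" by (simp add: gap_def)
  then have "2 ^ (n + 1) * (r m - r n) < 2 ^ (n + 1) * gap (A n) z" by simp
  moreover have "2 ^ (n + 1) * (r m - r n) = 1"
    unfolding r_def m by (simp add: power_one_over field_simps)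
  ultimately have "1 < 2 ^ (card (A n) + 1) * gap (A n) z" by (simp only: card)
  with finA show thesis using iA[of n] by (intro that[of "A n"]) auto
qed

lemma weight_1_of_large_gap: "1 < 2 ^ (card \<sigma> + 1) * gap \<sigma> z \<Longrightarrow> weight \<sigma> z = 1"
  by (simp add: weight_def)


section \<open>Sliding a point along the contractions of the active simplices\<close>

text \<open>One step of the motion: the chain of active simplices has at most one member with \<open>n\<close> vertices,
  and if there is none the point rests. Stepping by cardinality avoids listing the chain.\<close>

definition push :: "('j set \<Rightarrow> 'a \<times> real \<Rightarrow> 'a) \<Rightarrow> nat \<Rightarrow> 'a \<Rightarrow> ('j \<Rightarrow> real) \<Rightarrow> 'a" where
  "push F n x z =
     (if \<exists>\<sigma>. active \<sigma> z \<and> card \<sigma> = n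
      then let \<sigma> = (THE \<sigma>. active \<sigma> z \<and> card \<sigma> = n) in F \<sigma> (x, weight \<sigma> z)
      else x)"

primrec slide :: "('j set \<Rightarrow> 'a \<times> real \<Rightarrow> 'a) \<Rightarrow> nat \<Rightarrow> 'a \<Rightarrow> ('j \<Rightarrow> real) \<Rightarrow> 'a" where
  "slide F 0 x z = x"
| "slide F (Suc n) x z = slide F n (push F (Suc n) x z) z"

lemma push_active:
  assumes "active \<sigma> z" "card \<sigma> = n" "finite (supp z)"
  shows "push F n x z = F \<sigma> (x, weight \<sigma> z)"
proof -
  have "(THE \<sigma>. active \<sigma> z \<and> card \<sigma> = n) = \<sigma>"
  proof (rule the_equality)
    fix \<tau> assume \<tau>: "active \<tau> z \<and> card \<tau> = n"
    show "\<tau> = \<sigma>"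
      using active_chain[of \<tau> z \<sigma>] active_chain[of \<sigma> z \<tau>] \<tau> assms by auto
  qed (use assms in simp)
  with assms show ?thesis unfolding push_def by auto
qed

lemma push_inactive: "\<nexists>\<sigma>. active \<sigma> z \<and> card \<sigma> = n \<Longrightarrow> push F n x z = x"
  unfolding push_def by auto

text \<open>An active simplex is contained in the support, so steps beyond its cardinality do nothing. This
  replaces a number of steps that varies with \<open>z\<close> by one that is locally constant.\<close>

lemma slide_stable:
  assumes "finite (supp z)" "card (supp z) \<le> n"
  shows "slide F n x z = slide F (card (supp z)) x z"
  using assms(2)
proof (induction n)
  case (Suc n)
  show ?case
  proof (cases "card (supp z) = Suc n")
    case False
    with Suc.prems have le: "card (supp z) \<le> n" by simp
    have "\<nexists>\<sigma>. active \<sigma> z \<and> card \<sigma> = Suc n"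
      using card_mono[OF assms(1) active_subset_supp[OF _ assms(1)]] le by fastforce
    then show ?thesis using Suc.IH[OF le] by (simp add: push_inactive)
  qed simp
qed simp

text \<open>What the good covering contributes, with a contraction \<open>F \<sigma>\<close> to a base point \<open>p \<sigma>\<close> chosen for
  each simplex.\<close>

locale contractible_cover =
  fixes M :: "'a metric" and J :: "'j set" and U :: "'j \<Rightarrow> 'a set"
    and F :: "'j set \<Rightarrow> 'a \<times> real \<Rightarrow> 'a" and p :: "'j set \<Rightarrow> 'a"
  assumes cover: "locally_finite_open_covering M J U"
    and star_finite: "\<And>j. j \<in> J \<Longrightarrow> finite {k\<in>J. U j \<inter> U k \<noteq> {}}"
    and base_point: "\<And>\<sigma>. \<sigma> \<in> nerve J U \<Longrightarrow> p \<sigma> \<in> (\<Inter>j\<in>\<sigma>. U j)"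
    and contraction: "\<And>\<sigma>. \<sigma> \<in> nerve J U \<Longrightarrow>
      Lipschitz_strong_deformation_retraction (submetric M (\<Inter>j\<in>\<sigma>. U j)) {p \<sigma>} (F \<sigma>)"
begin

lemma U_subset: "j \<in> J \<Longrightarrow> U j \<subseteq> mspace M"
  using cover unfolding locally_finite_open_covering_def by auto

lemma simplex_subset: "\<sigma> \<in> nerve J U \<Longrightarrow> (\<Inter>j\<in>\<sigma>. U j) \<subseteq> mspace M"
  using U_subset unfolding nerve_def by blast

lemma contraction_simps:
  assumes "\<sigma> \<in> nerve J U" "x \<in> (\<Inter>j\<in>\<sigma>. U j)"
  shows "F \<sigma> (x, 0) = x" "F \<sigma> (x, 1) = p \<sigma>"
    "0 \<le> t \<Longrightarrow> t \<le> 1 \<Longrightarrow> F \<sigma> (x, t) \<in> (\<Inter>j\<in>\<sigma>. U j)"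
proof -
  have x: "x \<in> mspace (submetric M (\<Inter>j\<in>\<sigma>. U j))"
    using assms simplex_subset by auto
  then show "F \<sigma> (x, 0) = x" "F \<sigma> (x, 1) = p \<sigma>"
    using contraction[OF assms(1)] unfolding Lipschitz_strong_deformation_retraction_def by blast+
  assume "0 \<le> t" "t \<le> 1"
  have "F \<sigma> \<in> mspace (prod_metric (submetric M (\<Inter>j\<in>\<sigma>. U j)) unit_interval_metric)
      \<rightarrow> mspace (submetric M (\<Inter>j\<in>\<sigma>. U j))"
    using contraction[OF assms(1)] unfolding Lipschitz_strong_deformation_retraction_def
    by (intro Lipschitz_continuous_map_image) blast
  moreover have "(x, t) \<in> mspace (prod_metric (submetric M (\<Inter>j\<in>\<sigma>. U j)) unit_interval_metric)"
    using x \<open>0 \<le> t\<close> \<open>t \<le> 1\<close> by simp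
  ultimately have "F \<sigma> (x, t) \<in> mspace (submetric M (\<Inter>j\<in>\<sigma>. U j))"
    by (rule funcset_mem)
  then show "F \<sigma> (x, t) \<in> (\<Inter>j\<in>\<sigma>. U j)" by simp
qed

lemma contraction_Lipschitz:
  assumes "\<sigma> \<in> nerve J U"
  shows "\<exists>L\<ge>0. \<forall>x\<in>(\<Inter>j\<in>\<sigma>. U j). \<forall>x'\<in>(\<Inter>j\<in>\<sigma>. U j). \<forall>t\<in>{0..1}. \<forall>t'\<in>{0..1}.
    mdist M (F \<sigma> (x, t)) (F \<sigma> (x', t')) \<le> L * (mdist M x x' + \<bar>t - t'\<bar>)"
proof -
  let ?I = "\<Inter>j\<in>\<sigma>. U j"
  have "Lipschitz_continuous_map (prod_metric (submetric M ?I) unit_interval_metric)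
      (submetric M ?I) (F \<sigma>)"
    using contraction[OF assms] unfolding Lipschitz_strong_deformation_retraction_def by blast
  then obtain L where "L > 0" and L: "\<forall>q\<in>?I \<times> {0..1}. \<forall>q'\<in>?I \<times> {0..1}.
      mdist M (F \<sigma> q) (F \<sigma> q') \<le> L * prod_dist (mdist M) dist q q'"
    using simplex_subset[OF assms] unfolding Lipschitz_continuous_map_pos
    by (auto simp: Int_absorb2)
  have "mdist M (F \<sigma> (x, t)) (F \<sigma> (x', t')) \<le> L * (mdist M x x' + \<bar>t - t'\<bar>)"
    if "x \<in> ?I" "x' \<in> ?I" "t \<in> {0..1}" "t' \<in> {0..1}" for x x' t t'
  proof -
    have "mdist M (F \<sigma> (x, t)) (F \<sigma> (x', t')) \<le> L * prod_dist (mdist M) dist (x, t) (x', t')"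
      using L that by blast
    also have "\<dots> \<le> L * (mdist M x x' + \<bar>t - t'\<bar>)"
    proof (rule mult_left_mono)
      show "prod_dist (mdist M) dist (x, t) (x', t') \<le> mdist M x x' + \<bar>t - t'\<bar>"
        using sqrt_sum_squares_le_sum_abs[of "mdist M x x'" "t - t'"]
        by (simp add: prod_dist_def dist_real_def mdist_nonneg)
    qed (use \<open>L > 0\<close> in simp)
    finally show ?thesis .
  qed
  with \<open>L > 0\<close> show ?thesis by (intro exI[of _ L]) auto
qed

text \<open>The pairs for which all steps from level \<open>n\<close> down stay within the domains of the contractions.\<close>

definition admissible :: "nat \<Rightarrow> 'a \<Rightarrow> ('j \<Rightarrow> real) \<Rightarrow> bool" where
  "admissible n x z \<longleftrightarrow> x \<in> mspace M \<and> finite (supp z) \<and> supp z \<subseteq> J \<and>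
     (\<forall>\<sigma>. active \<sigma> z \<and> card \<sigma> \<le> n \<longrightarrow> x \<in> (\<Inter>j\<in>\<sigma>. U j))"

lemma admissible_of_supp:
  assumes "x \<in> mspace M" "finite (supp z)" "supp z \<subseteq> J" "\<And>j. j \<in> supp z \<Longrightarrow> x \<in> U j"
  shows "admissible n x z"
  unfolding admissible_def
proof (intro conjI allI impI INT_I)
  fix \<sigma> j assume "active \<sigma> z \<and> card \<sigma> \<le> n" "j \<in> \<sigma>"
  then show "x \<in> U j" using active_subset_supp[OF _ assms(2)] assms(4) by blast
qed (use assms in auto)

lemma active_in_nerve:
  assumes "admissible n x z" "active \<sigma> z" "card \<sigma> \<le> n"
  shows "\<sigma> \<in> nerve J U" "x \<in> (\<Inter>j\<in>\<sigma>. U j)"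
proof -
  show x: "x \<in> (\<Inter>j\<in>\<sigma>. U j)" using assms unfolding admissible_def by blast
  have "\<sigma> \<subseteq> J" using assms(1) active_subset_supp[OF assms(2)] unfolding admissible_def by auto
  moreover have "finite \<sigma>" "\<sigma> \<noteq> {}" using assms(2) by (auto simp: active_def)
  ultimately show "\<sigma> \<in> nerve J U" using x unfolding nerve_def by blast
qed

lemma push_cases:
  assumes "admissible n x z"
  obtains (active) \<sigma> where "active \<sigma> z" "card \<sigma> = n" "\<sigma> \<in> nerve J U" "x \<in> (\<Inter>j\<in>\<sigma>. U j)"
      "push F n x z = F \<sigma> (x, weight \<sigma> z)" "push F n x z \<in> (\<Inter>j\<in>\<sigma>. U j)"
    | (inactive) "\<nexists>\<sigma>. active \<sigma> z \<and> card \<sigma> = n" "push F n x z = x"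
proof (cases "\<exists>\<sigma>. active \<sigma> z \<and> card \<sigma> = n")
  case True
  then obtain \<sigma> where \<sigma>: "active \<sigma> z" "card \<sigma> = n" by blast
  note nerve = active_in_nerve[OF assms \<sigma>(1) eq_imp_le[OF \<sigma>(2)]]
  have eq: "push F n x z = F \<sigma> (x, weight \<sigma> z)"
    using assms by (intro push_active[OF \<sigma>]) (simp add: admissible_def)
  show thesis
    using contraction_simps(3)[OF nerve, of "weight \<sigma> z"] eq
    by (intro active[OF \<sigma> nerve eq]) simp
next
  case False
  then show thesis using push_inactive[OF False] by (rule inactive)
qed

text \<open>After the step the point lies in the intersection for a simplex with \<open>n + 1\<close> vertices, hence in
  those for its faces, and the smaller active simplices are such faces.\<close>

lemma push_admissible:
  assumes "admissible (Suc n) x z"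
  shows "admissible n (push F (Suc n) x z) z"
  using assms
proof (cases rule: push_cases)
  case (active \<sigma>)
  have fin: "finite (supp z)" using assms by (simp add: admissible_def)
  have "push F (Suc n) x z \<in> (\<Inter>j\<in>\<tau>. U j)" if "active \<tau> z \<and> card \<tau> \<le> n" for \<tau>
  proof -
    have "\<tau> \<subseteq> \<sigma>" using active_chain[OF _ active(1) fin, of \<tau>] that active(2) by simp
    with active(6) show ?thesis by blast
  qed
  moreover have "push F (Suc n) x z \<in> mspace M"
    using active(6) simplex_subset[OF active(3)] by (rule set_rev_mp)
  ultimately show ?thesis
    using assms unfolding admissible_def by (intro conjI allI impI) simp_all
next
  case inactive
  with assms show ?thesis unfolding admissible_def by auto
qed

lemma slide_in_mspace: "admissible n x z \<Longrightarrow> slide F n x z \<in> mspace M"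
proof (induction n arbitrary: x)
  case 0
  then show ?case by (simp add: admissible_def)
next
  case (Suc n)
  then show ?case using push_admissible by simp
qed

text \<open>Every active simplex contains \<open>j\<close>, so no step leaves \<open>U j\<close>.\<close>

lemma slide_in_maximal:
  assumes "admissible n x z" "x \<in> U j" "\<And>k. z k \<le> z j"
  shows "slide F n x z \<in> U j"
  using assms(1,2)
proof (induction n arbitrary: x)
  case (Suc n)
  from Suc.prems(1) have "push F (Suc n) x z \<in> U j"
  proof (cases rule: push_cases)
    case (active \<sigma>)
    have "finite (supp z)" using assms(1) by (simp add: admissible_def)
    from active_contains_maximal[OF active(1) this assms(3)] active(6) show ?thesis by simp
  qed (use Suc.prems in auto)
  then show ?case using Suc.IH push_admissible[OF Suc.prems(1)] by simp
qed simp

text \<open>At the step of \<open>\<sigma>\<close> the contraction runs to its end, so the result depends on the starting point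
  no more; only the steps below the level of \<open>\<sigma>\<close> remain.\<close>

lemma slide_reset:
  assumes "admissible n x z" "active \<sigma> z" "weight \<sigma> z = 1" "card \<sigma> \<le> n"
  shows "slide F n x z = slide F (card \<sigma> - 1) (p \<sigma>) z"
  using assms(1,4)
proof (induction n arbitrary: x)
  case 0
  then show ?case using assms(2) by (simp add: active_def)
next
  case (Suc n)
  show ?case
  proof (cases "card \<sigma> = Suc n")
    case True
    have fin: "finite (supp z)" using assms(1) by (simp add: admissible_def)
    have "push F (Suc n) x z = p \<sigma>"
      using push_active[OF assms(2) True fin, of F x] assms(3)
        contraction_simps(2)[OF active_in_nerve[OF Suc.prems(1) assms(2) Suc.prems(2)]] by simp
    with True show ?thesis by simp
  next
    case False
    with Suc show ?thesis using push_admissible by simp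
  qed
qed


lemma uniform_contraction_constant:
  assumes "finite W"
  shows "\<exists>L\<ge>0. \<forall>\<sigma>\<in>nerve J U. \<sigma> \<subseteq> W \<longrightarrow>
    (\<forall>x\<in>(\<Inter>j\<in>\<sigma>. U j). \<forall>x'\<in>(\<Inter>j\<in>\<sigma>. U j). \<forall>t\<in>{0..1}. \<forall>t'\<in>{0..1}.
      mdist M (F \<sigma> (x, t)) (F \<sigma> (x', t')) \<le> L * (mdist M x x' + \<bar>t - t'\<bar>))"
proof -
  let ?P = "\<lambda>\<sigma> L. 0 \<le> L \<and> (\<forall>x\<in>(\<Inter>j\<in>\<sigma>. U j). \<forall>x'\<in>(\<Inter>j\<in>\<sigma>. U j). \<forall>t\<in>{0..1}. \<forall>t'\<in>{0..1}.
    mdist M (F \<sigma> (x, t)) (F \<sigma> (x', t')) \<le> L * (mdist M x x' + \<bar>t - t'\<bar>))"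
  have "\<exists>L. \<forall>\<sigma>\<in>nerve J U. ?P \<sigma> (L \<sigma>)"
    using contraction_Lipschitz by (intro bchoice) blast
  then obtain L where L: "\<forall>\<sigma>\<in>nerve J U. ?P \<sigma> (L \<sigma>)" by (elim exE) (rule that)
  let ?S = "nerve J U \<inter> Pow W"
  have fin: "finite ?S" using assms by simp
  show ?thesis
  proof (intro exI[of _ "sum L ?S"] conjI ballI impI)
    show "0 \<le> sum L ?S" using L by (intro sum_nonneg) auto
    fix \<sigma> x x' and t t' :: real
    assume *: "\<sigma> \<in> nerve J U" "\<sigma> \<subseteq> W"
      and **: "x \<in> (\<Inter>j\<in>\<sigma>. U j)" "x' \<in> (\<Inter>j\<in>\<sigma>. U j)" "t \<in> {0..1}" "t' \<in> {0..1}"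
    have L\<sigma>: "?P \<sigma> (L \<sigma>)" using L *(1) by (rule bspec)
    have "mdist M (F \<sigma> (x, t)) (F \<sigma> (x', t')) \<le> L \<sigma> * (mdist M x x' + \<bar>t - t'\<bar>)"
      using conjunct2[OF L\<sigma>] ** by (simp only:)
    also have "\<dots> \<le> sum L ?S * (mdist M x x' + \<bar>t - t'\<bar>)"
      using * L fin by (intro mult_right_mono member_le_sum) (auto simp: mdist_nonneg)
    finally show "mdist M (F \<sigma> (x, t)) (F \<sigma> (x', t')) \<le> sum L ?S * (mdist M x x' + \<bar>t - t'\<bar>)" .
  qed
qed

text \<open>The constant is uniform over all admissible points and all vectors supported in \<open>W\<close>: vectors that
  are close need not have the same superlevel sets.\<close>

definition Lipschitz_action :: "nat \<Rightarrow> 'j set \<Rightarrow> ('a \<Rightarrow> ('j \<Rightarrow> real) \<Rightarrow> 'a) \<Rightarrow> bool" where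
  "Lipschitz_action n W T \<longleftrightarrow>
     (\<exists>C\<ge>0. \<forall>x x' z z' \<delta>. admissible n x z \<longrightarrow> admissible n x' z' \<longrightarrow>
        supp z \<subseteq> W \<longrightarrow> supp z' \<subseteq> W \<longrightarrow> (\<forall>j. \<bar>z j - z' j\<bar> \<le> \<delta>) \<longrightarrow>
        mdist M (T x z) (T x' z') \<le> C * (mdist M x x' + \<delta>))"

lemma push_Lipschitz:
  assumes "finite W"
  shows "Lipschitz_action n W (push F n)"
proof -
  obtain L where L0: "0 \<le> L" and L: "\<forall>\<sigma>\<in>nerve J U. \<sigma> \<subseteq> W \<longrightarrow>
    (\<forall>x\<in>(\<Inter>j\<in>\<sigma>. U j). \<forall>x'\<in>(\<Inter>j\<in>\<sigma>. U j). \<forall>t\<in>{0..1}. \<forall>t'\<in>{0..1}.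
      mdist M (F \<sigma> (x, t)) (F \<sigma> (x', t')) \<le> L * (mdist M x x' + \<bar>t - t'\<bar>))"
    using uniform_contraction_constant[OF assms] by (elim exE conjE) (rule that)
  define D :: real where "D = 2 ^ (n + 2)"
  have D: "0 \<le> D" by (simp add: D_def)
  \<comment> \<open>A simplex active for only one of the two vectors has a weight of at most \<open>D * \<delta>\<close>,
      and it moves its point by at most \<open>L\<close> times that, since \<open>F \<sigma> (x, 0) = x\<close>.\<close>
  have move: "mdist M (push F n x z) x \<le> L * (D * \<delta>)"
    if adm: "admissible n x z" "admissible n x' z'" and W: "supp z \<subseteq> W"
      and \<delta>: "\<And>j. \<bar>z j - z' j\<bar> \<le> \<delta>" and not_both: "\<nexists>\<sigma>. active \<sigma> z \<and> active \<sigma> z' \<and> card \<sigma> = n"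
    for x x' z z' \<delta>
    using adm(1)
  proof (cases rule: push_cases)
    case (active \<sigma>)
    have fin: "finite (supp z)" "finite (supp z')" using adm by (auto simp: admissible_def)
    have fin\<sigma>: "finite \<sigma>" "\<sigma> \<noteq> {}" using active(1) by (auto simp: active_def)
    have "\<not> active \<sigma> z'" using not_both active(1,2) by blast
    then have "weight \<sigma> z' = 0"
      using fin\<sigma> weight_bounds(1)[of \<sigma> z'] unfolding active_def by linarith
    with weight_diff[OF fin\<sigma> fin \<delta>] active(2) have w: "weight \<sigma> z \<le> D * \<delta>"
      by (simp add: D_def)
    have "mdist M (F \<sigma> (x, weight \<sigma> z)) (F \<sigma> (x, 0)) \<le> L * (mdist M x x + \<bar>weight \<sigma> z - 0\<bar>)"
      by (rule L[rule_format, OF active(3) _ active(4,4)])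
         (use active_subset_supp[OF active(1) fin(1)] W in auto)
    also have "\<dots> \<le> L * (D * \<delta>)"
    proof (rule mult_left_mono)
      have "mdist M x x = 0" using adm(1) by (simp add: admissible_def)
      with w show "mdist M x x + \<bar>weight \<sigma> z - 0\<bar> \<le> D * \<delta>" by simp
    qed (rule L0)
    finally show ?thesis
      using contraction_simps(1)[OF active(3,4)] active(5) by simp
  next
    case inactive
    have "0 \<le> \<delta>" using \<delta> abs_ge_zero order_trans by blast
    moreover have "mdist M x x = 0" using adm(1) by (simp add: admissible_def)
    ultimately show ?thesis using inactive(2) L0 D by simp
  qed
  let ?C = "1 + L + 2 * (L * D)"
  show ?thesis
    unfolding Lipschitz_action_def
  proof (intro exI[of _ ?C] conjI allI impI)
    show "0 \<le> ?C" using L0 D by simp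
    fix x x' z z' \<delta>
    assume adm: "admissible n x z" "admissible n x' z'" and W: "supp z \<subseteq> W" "supp z' \<subseteq> W"
      and "\<forall>j. \<bar>z j - z' j\<bar> \<le> \<delta>"
    then have \<delta>: "\<bar>z j - z' j\<bar> \<le> \<delta>" for j by blast
    have \<delta>0: "0 \<le> \<delta>" using \<delta> abs_ge_zero order_trans by blast
    have LD: "0 \<le> L * D" using L0 D by simp
    have fin: "finite (supp z)" "finite (supp z')" and x: "x \<in> mspace M" "x' \<in> mspace M"
      using adm by (auto simp: admissible_def)
    show "mdist M (push F n x z) (push F n x' z') \<le> ?C * (mdist M x x' + \<delta>)"
    proof (cases "\<exists>\<sigma>. active \<sigma> z \<and> active \<sigma> z' \<and> card \<sigma> = n")
      case True
      then obtain \<sigma> where \<sigma>: "active \<sigma> z" "active \<sigma> z'" "card \<sigma> = n" by blast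
      have fin\<sigma>: "finite \<sigma>" "\<sigma> \<noteq> {}" using \<sigma>(1) by (auto simp: active_def)
      have "mdist M (push F n x z) (push F n x' z') =
          mdist M (F \<sigma> (x, weight \<sigma> z)) (F \<sigma> (x', weight \<sigma> z'))"
        by (simp only: push_active[OF \<sigma>(1,3) fin(1)] push_active[OF \<sigma>(2,3) fin(2)])
      also have "\<dots> \<le> L * (mdist M x x' + \<bar>weight \<sigma> z - weight \<sigma> z'\<bar>)"
        by (rule L[rule_format, OF active_in_nerve(1)[OF adm(1) \<sigma>(1)] _
              active_in_nerve(2)[OF adm(1) \<sigma>(1)] active_in_nerve(2)[OF adm(2) \<sigma>(2)]])
           (use active_subset_supp[OF \<sigma>(1) fin(1)] W(1) \<sigma>(3) in auto)
      also have "\<dots> \<le> L * (mdist M x x' + D * \<delta>)"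
        using weight_diff[OF fin\<sigma> fin \<delta>] \<sigma>(3) L0 by (intro mult_left_mono) (auto simp: D_def)
      also have "\<dots> \<le> ?C * (mdist M x x' + \<delta>)"
        using L0 LD \<delta>0 mdist_nonneg[of M x x']
          mult_nonneg_nonneg[OF LD mdist_nonneg[of M x x']] mult_nonneg_nonneg[OF LD \<delta>0]
          mult_nonneg_nonneg[OF L0 \<delta>0]
        by (simp add: algebra_simps)
      finally show ?thesis .
    next
      case False
      have push_in: "push F n x z \<in> mspace M" if "admissible n x z" for x z
        using that
      proof (cases rule: push_cases)
        case (active \<sigma>)
        show ?thesis using active(6) simplex_subset[OF active(3)] by (rule set_rev_mp)
      qed (use that in \<open>auto simp: admissible_def\<close>)
      have 1: "mdist M (push F n x z) x \<le> L * (D * \<delta>)"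
        by (rule move[OF adm W(1) \<delta> False])
      have "mdist M (push F n x' z') x' \<le> L * (D * \<delta>)"
      proof (rule move[OF adm(2,1) W(2)])
        show "\<bar>z' j - z j\<bar> \<le> \<delta>" for j using \<delta>[of j] by (simp add: abs_minus_commute)
      qed (use False in blast)
      then have 2: "mdist M x' (push F n x' z') \<le> L * (D * \<delta>)" by (simp add: mdist_commute)
      have "mdist M (push F n x z) (push F n x' z')
          \<le> mdist M (push F n x z) x + mdist M x (push F n x' z')"
        using push_in adm x by (intro mdist_triangle) auto
      also have "mdist M x (push F n x' z') \<le> mdist M x x' + mdist M x' (push F n x' z')"
        using push_in adm x by (intro mdist_triangle) auto
      finally have "mdist M (push F n x z) (push F n x' z') \<le> mdist M x x' + 2 * (L * (D * \<delta>))"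
        using 1 2 by linarith
      also have "\<dots> \<le> ?C * (mdist M x x' + \<delta>)"
        using L0 LD \<delta>0 mdist_nonneg[of M x x']
          mult_nonneg_nonneg[OF LD mdist_nonneg[of M x x']]
          mult_nonneg_nonneg[OF L0 \<delta>0] mult_nonneg_nonneg[OF L0 mdist_nonneg[of M x x']]
        by (simp add: algebra_simps)
      finally show ?thesis .
    qed
  qed
qed

lemma slide_Lipschitz:
  assumes "finite W"
  shows "Lipschitz_action n W (slide F n)"
proof (induction n)
  case 0
  show ?case
    unfolding Lipschitz_action_def
  proof (intro exI[of _ 1] conjI allI impI)
    fix x x' \<delta> and z z' :: "'j \<Rightarrow> real"
    assume "\<forall>j. \<bar>z j - z' j\<bar> \<le> \<delta>"
    then have "0 \<le> \<delta>" using abs_ge_zero order_trans by blast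
    then show "mdist M (slide F 0 x z) (slide F 0 x' z') \<le> 1 * (mdist M x x' + \<delta>)" by simp
  qed simp
next
  case (Suc n)
  obtain C where C0: "0 \<le> C" and C: "\<forall>x x' z z' \<delta>. admissible n x z \<longrightarrow> admissible n x' z' \<longrightarrow>
        supp z \<subseteq> W \<longrightarrow> supp z' \<subseteq> W \<longrightarrow> (\<forall>j. \<bar>z j - z' j\<bar> \<le> \<delta>) \<longrightarrow>
        mdist M (slide F n x z) (slide F n x' z') \<le> C * (mdist M x x' + \<delta>)"
    using Suc.IH unfolding Lipschitz_action_def by (elim exE conjE) (rule that)
  obtain B where B0: "0 \<le> B" and B: "\<forall>x x' z z' \<delta>. admissible (Suc n) x z \<longrightarrow>
        admissible (Suc n) x' z' \<longrightarrow> supp z \<subseteq> W \<longrightarrow> supp z' \<subseteq> W \<longrightarrow> (\<forall>j. \<bar>z j - z' j\<bar> \<le> \<delta>) \<longrightarrow>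
        mdist M (push F (Suc n) x z) (push F (Suc n) x' z') \<le> B * (mdist M x x' + \<delta>)"
    using push_Lipschitz[OF assms, of "Suc n"] unfolding Lipschitz_action_def
    by (elim exE conjE) (rule that)
  show ?case
    unfolding Lipschitz_action_def
  proof (intro exI[of _ "C * (B + 1)"] conjI allI impI)
    show "0 \<le> C * (B + 1)" using B0 C0 by simp
    fix x x' z z' \<delta>
    assume adm: "admissible (Suc n) x z" "admissible (Suc n) x' z'"
      and W: "supp z \<subseteq> W" "supp z' \<subseteq> W" and \<delta>: "\<forall>j. \<bar>z j - z' j\<bar> \<le> \<delta>"
    have "mdist M (slide F (Suc n) x z) (slide F (Suc n) x' z')
        \<le> C * (mdist M (push F (Suc n) x z) (push F (Suc n) x' z') + \<delta>)"
      using C[rule_format, OF push_admissible[OF adm(1)] push_admissible[OF adm(2)] W] \<delta> by simp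
    also have "\<dots> \<le> C * (B * (mdist M x x' + \<delta>) + (mdist M x x' + \<delta>))"
      using B[rule_format, OF adm W] \<delta> C0 by (intro mult_left_mono add_mono) (auto simp: mdist_nonneg)
    also have "\<dots> = C * (B + 1) * (mdist M x x' + \<delta>)" by (simp add: algebra_simps)
    finally show "mdist M (slide F (Suc n) x z) (slide F (Suc n) x' z')
        \<le> C * (B + 1) * (mdist M x x' + \<delta>)" .
  qed
qed


text \<open>Serves the map from the nerve with a constant \<open>\<xi>\<close>, and the homotopy on \<open>M\<close> with the projection
  to \<open>M\<close>.\<close>

lemma slide_near:
  assumes \<xi>: "Lipschitz_near X q (mdist M) \<xi>" and z: "Lipschitz_vector_near X q z"
    and adm: "\<forall>\<^sub>F u in near X q. admissible n (\<xi> u) (z u)"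
  shows "Lipschitz_near X q (mdist M) (\<lambda>u. slide F n (\<xi> u) (z u))"
proof -
  obtain A where A: "A \<ge> 0" "\<forall>\<^sub>F u in near X q \<times>\<^sub>F near X q.
      mdist M (\<xi> (fst u)) (\<xi> (snd u)) \<le> A * mdist X (fst u) (snd u)"
    using \<xi> by (rule Lipschitz_nearE)
  obtain C W where C: "0 \<le> C" "finite W" "\<forall>\<^sub>F u in near X q. supp (z u) \<subseteq> W"
    "\<forall>\<^sub>F u in near X q \<times>\<^sub>F near X q.
       \<forall>j. \<bar>z (fst u) j - z (snd u) j\<bar> \<le> C * mdist X (fst u) (snd u)"
    using z by (rule Lipschitz_vector_nearE)
  obtain B where B0: "0 \<le> B" and B: "\<forall>x x' z z' \<delta>. admissible n x z \<longrightarrow> admissible n x' z' \<longrightarrow>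
        supp z \<subseteq> W \<longrightarrow> supp z' \<subseteq> W \<longrightarrow> (\<forall>j. \<bar>z j - z' j\<bar> \<le> \<delta>) \<longrightarrow>
        mdist M (slide F n x z) (slide F n x' z') \<le> B * (mdist M x x' + \<delta>)"
    using slide_Lipschitz[OF C(2), of n] unfolding Lipschitz_action_def by (elim exE conjE) (rule that)
  have "\<forall>\<^sub>F u in near X q \<times>\<^sub>F near X q.
      mdist M (slide F n (\<xi> (fst u)) (z (fst u))) (slide F n (\<xi> (snd u)) (z (snd u)))
        \<le> (B * (A + C)) * mdist X (fst u) (snd u)"
    using A(2) C(4) eventually_near_pairs[OF C(3)] eventually_near_pairs[OF adm]
  proof eventually_elim
    case (elim u)
    have "mdist M (slide F n (\<xi> (fst u)) (z (fst u))) (slide F n (\<xi> (snd u)) (z (snd u)))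
        \<le> B * (mdist M (\<xi> (fst u)) (\<xi> (snd u)) + C * mdist X (fst u) (snd u))"
      using elim by (intro B[rule_format]) simp_all
    also have "\<dots> \<le> B * (A * mdist X (fst u) (snd u) + C * mdist X (fst u) (snd u))"
      using elim(1) B0 by (intro mult_left_mono) auto
    finally show ?case by (simp add: algebra_simps)
  qed
  then show ?thesis unfolding Lipschitz_near_def by (rule exI)
qed


section \<open>The map to the nerve\<close>

text \<open>The distance to the complement of \<open>U j\<close>, cut off at \<open>1\<close> so that it is defined (and positive) also
  when the complement is empty.\<close>

definition depth :: "'a \<Rightarrow> 'j \<Rightarrow> real" where
  "depth x j = (if j \<in> J then Inf (insert 1 (mdist M x ` (mspace M - U j))) else 0)"

lemma depth_bdd: "bdd_below (insert 1 (mdist M x ` A))"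
  by (rule bdd_belowI[of _ 0]) auto

lemma depth_nonneg: "0 \<le> depth x j"
  unfolding depth_def by (auto intro!: cInf_greatest)

lemma depth_Lipschitz:
  assumes "u \<in> mspace M" "v \<in> mspace M"
  shows "\<bar>depth u j - depth v j\<bar> \<le> mdist M u v"
proof -
  have le: "depth u j - mdist M u v \<le> depth v j" if "u \<in> mspace M" "v \<in> mspace M" "j \<in> J" for u v
  proof -
    have "Inf (insert 1 (mdist M u ` (mspace M - U j))) - mdist M u v \<le> r"
      if r: "r \<in> insert 1 (mdist M v ` (mspace M - U j))" for r
    proof (cases "r = 1")
      case True
      have "Inf (insert 1 (mdist M u ` (mspace M - U j))) \<le> 1"
        by (rule cInf_lower[OF _ depth_bdd]) simp
      with True show ?thesis using mdist_nonneg[of M u v] by linarith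
    next
      case False
      with r obtain w where w: "w \<in> mspace M - U j" "r = mdist M v w" by auto
      have "Inf (insert 1 (mdist M u ` (mspace M - U j))) \<le> mdist M u w"
        using w(1) by (intro cInf_lower[OF _ depth_bdd]) auto
      also have "\<dots> \<le> mdist M u v + mdist M v w"
        using w(1) \<open>u \<in> mspace M\<close> \<open>v \<in> mspace M\<close> by (intro mdist_triangle) auto
      finally show ?thesis using w(2) by simp
    qed
    then show ?thesis
      using \<open>j \<in> J\<close> unfolding depth_def by (simp only: if_True) (rule cInf_greatest, auto)
  qed
  show ?thesis
  proof (cases "j \<in> J")
    case True
    with le[of u v] le[of v u] assms mdist_commute[of M u v] show ?thesis by simp
  next
    case False
    then show ?thesis by (simp add: depth_def)
  qed
qed

lemma depth_nonzero_iff: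
  assumes "x \<in> mspace M"
  shows "depth x j \<noteq> 0 \<longleftrightarrow> j \<in> J \<and> x \<in> U j"
proof (cases "j \<in> J")
  case j: True
  interpret Metric_space "mspace M" "mdist M" by simp
  show ?thesis
  proof (cases "x \<in> U j")
    case True
    have "openin (mtopology_of M) (U j)"
      using cover j unfolding locally_finite_open_covering_def by simp
    then obtain e where e: "0 < e" "mball x e \<subseteq> U j"
      using True unfolding mtopology_of_def openin_mtopology by auto
    have "min 1 e \<le> Inf (insert 1 (mdist M x ` (mspace M - U j)))"
    proof (rule cInf_greatest)
      fix r assume "r \<in> insert 1 (mdist M x ` (mspace M - U j))"
      then consider "r = 1" | w where "w \<in> mspace M - U j" "r = mdist M x w" by auto
      then show "min 1 e \<le> r"
      proof cases
        case 2
        then have "w \<notin> mball x e" using e(2) by auto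
        with 2 assms show ?thesis by auto
      qed simp
    qed simp
    with e(1) j True show ?thesis by (simp add: depth_def)
  next
    case False
    have "Inf (insert 1 (mdist M x ` (mspace M - U j))) \<le> mdist M x x"
      using False assms by (intro cInf_lower[OF _ depth_bdd] insertI2 imageI) simp
    then have "depth x j \<le> 0" using j assms by (simp add: depth_def)
    with depth_nonneg[of x j] False show ?thesis by simp
  qed
qed (simp add: depth_def)

lemma supp_depth: "x \<in> mspace M \<Longrightarrow> supp (depth x) = {j\<in>J. x \<in> U j}"
  by (auto simp: depth_nonzero_iff)

lemma locally_finite_near:
  assumes "x \<in> mspace M"
  obtains W where "finite W" "\<forall>\<^sub>F u in near M x. {j\<in>J. u \<in> U j} \<subseteq> W"
proof -
  obtain V where V: "openin (mtopology_of M) V" "x \<in> V" "finite {j\<in>J. U j \<inter> V \<noteq> {}}"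
    using cover assms unfolding locally_finite_open_covering_def by blast
  have "\<forall>\<^sub>F u in near M x. u \<in> V"
    unfolding eventually_nhdsin using V(1,2) by blast
  then have "\<forall>\<^sub>F u in near M x. {j\<in>J. u \<in> U j} \<subseteq> {j\<in>J. U j \<inter> V \<noteq> {}}"
    by eventually_elim auto
  with V(3) show thesis by (rule that)
qed

lemma containing_simplex:
  assumes "x \<in> mspace M"
  shows "{j\<in>J. x \<in> U j} \<in> nerve J U"
proof -
  obtain W where "finite W" "\<forall>\<^sub>F u in near M x. {j\<in>J. u \<in> U j} \<subseteq> W"
    using locally_finite_near[OF assms] .
  then have "finite {j\<in>J. x \<in> U j}"
    using assms unfolding eventually_nhdsin by (auto intro: finite_subset)
  moreover have "{j\<in>J. x \<in> U j} \<noteq> {}"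
    using cover assms unfolding locally_finite_open_covering_def by blast
  moreover have "x \<in> (\<Inter>j\<in>{j\<in>J. x \<in> U j}. U j)" by simp
  ultimately show ?thesis unfolding nerve_def by blast
qed

lemma Lipschitz_vector_near_depth:
  assumes "x \<in> mspace M"
  shows "Lipschitz_vector_near M x depth"
proof -
  obtain W where W: "finite W" "\<forall>\<^sub>F u in near M x. {j\<in>J. u \<in> U j} \<subseteq> W"
    using locally_finite_near[OF assms] .
  have "\<forall>\<^sub>F u in near M x. supp (depth u) \<subseteq> W"
    using W(2) eventually_near_mspace[of M x] by eventually_elim (simp only: supp_depth)
  moreover have "Lipschitz_near M x dist (\<lambda>u. depth u j)" for j
    by (rule Lipschitz_nearI[where P="\<lambda>_. True" and C=1])
       (simp_all add: dist_real_def depth_Lipschitz)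
  ultimately show ?thesis using W(1) by (intro Lipschitz_vector_nearI)
qed

lemma depth_props:
  assumes "x \<in> mspace M"
  shows "finite (supp (depth x))" "supp (depth x) \<in> nerve J U" "supp (depth x) \<noteq> {}"
    "0 < peak (depth x)"
proof -
  show nerve: "supp (depth x) \<in> nerve J U"
    using containing_simplex[OF assms] by (simp only: supp_depth[OF assms])
  then show fin: "finite (supp (depth x))" and ne: "supp (depth x) \<noteq> {}"
    unfolding nerve_def by blast+
  then show "0 < peak (depth x)" using depth_nonneg by (intro peak_pos)
qed

definition to_nerve :: "'a \<Rightarrow> 'j \<Rightarrow>\<^sub>0 real" where
  "to_nerve x = realise (depth x)"

abbreviation nerve_metric :: "('j \<Rightarrow>\<^sub>0 real) metric" where
  "nerve_metric \<equiv> geometric_realization (nerve J U)"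

lemma to_nerve_locally_Lipschitz: "locally_Lipschitz_map M nerve_metric to_nerve"
  unfolding to_nerve_def
  by (rule locally_Lipschitz_realise[OF nerve_closed])
     (assumption | rule depth_props depth_nonneg Lipschitz_vector_near_depth)+

lemma supp_lookup: "supp (Poly_Mapping.lookup y) = Poly_Mapping.keys y"
  by (auto simp: in_keys_iff)

lemma nerve_point:
  assumes "y \<in> mspace nerve_metric"
  shows "0 \<le> Poly_Mapping.lookup y j" "Poly_Mapping.keys y \<in> nerve J U"
    "sum (Poly_Mapping.lookup y) (Poly_Mapping.keys y) = 1"
    "Poly_Mapping.keys y \<subseteq> J" "Poly_Mapping.keys y \<noteq> {}" "0 < peak (Poly_Mapping.lookup y)"
proof -
  have y: "(\<forall>j. 0 \<le> Poly_Mapping.lookup y j) \<and> Poly_Mapping.keys y \<in> nerve J U \<and>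
     sum (Poly_Mapping.lookup y) (Poly_Mapping.keys y) = 1"
    by (rule iffD1[OF mspace_geometric_realization_iff assms])
       (assumption | rule nerve_closed)+
  then show "0 \<le> Poly_Mapping.lookup y j" "Poly_Mapping.keys y \<in> nerve J U"
    "sum (Poly_Mapping.lookup y) (Poly_Mapping.keys y) = 1" by simp_all
  then show "Poly_Mapping.keys y \<subseteq> J" and ne: "Poly_Mapping.keys y \<noteq> {}"
    unfolding nerve_def by simp_all
  show "0 < peak (Poly_Mapping.lookup y)"
    using y ne by (intro peak_pos) (simp_all add: supp_lookup)
qed


section \<open>The map from the nerve\<close>

definition capped :: "('j \<Rightarrow>\<^sub>0 real) \<Rightarrow> 'j \<Rightarrow> real" where
  "capped y = cap (Poly_Mapping.lookup y)"

lemma supp_capped: "y \<in> mspace nerve_metric \<Longrightarrow> supp (capped y) = Poly_Mapping.keys y"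
  unfolding capped_def using nerve_point(6) by (simp only: supp_cap supp_lookup)

lemma capped_le_1: "capped y j \<le> 1"
  unfolding capped_def by (rule cap_le_1)

lemma capped_reach_1:
  assumes "y \<in> mspace nerve_metric"
  obtains i where "capped y i = 1"
proof -
  have fin: "finite (supp (Poly_Mapping.lookup y))" by (simp only: supp_lookup finite_keys)
  obtain i where "Poly_Mapping.lookup y i = peak (Poly_Mapping.lookup y)"
    using peak_attained[OF fin nerve_point(6)[OF assms]] .
  then have "capped y i = 1"
    unfolding capped_def using nerve_point(6)[OF assms]
    by (subst cap_eq_1_iff) simp_all
  then show thesis by (rule that)
qed

text \<open>Any starting point common to the sets of the support gives the same result, see
  \<open>from_nerve_eq\<close>; the choice need not depend continuously on \<open>y\<close>.\<close>

definition from_nerve :: "('j \<Rightarrow>\<^sub>0 real) \<Rightarrow> 'a" where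
  "from_nerve y = slide F (card (Poly_Mapping.keys y))
     (SOME x. x \<in> (\<Inter>j\<in>Poly_Mapping.keys y. U j)) (capped y)"

lemma admissible_keys:
  assumes "y \<in> mspace nerve_metric" "x \<in> (\<Inter>j\<in>Poly_Mapping.keys y. U j)"
  shows "admissible n x (capped y)"
proof (rule admissible_of_supp)
  show "x \<in> mspace M"
    using assms(2) simplex_subset[OF nerve_point(2)[OF assms(1)]] by (rule set_rev_mp)
  show "finite (supp (capped y))" by (simp only: supp_capped[OF assms(1)] finite_keys)
  show "supp (capped y) \<subseteq> J"
    using nerve_point(4)[OF assms(1)] by (simp only: supp_capped[OF assms(1)])
  show "x \<in> U j" if "j \<in> supp (capped y)" for j
    using that assms(2) by (simp only: supp_capped[OF assms(1)] INT_iff)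
qed

lemma slide_capped:
  assumes y: "y \<in> mspace nerve_metric" and x: "x \<in> (\<Inter>j\<in>Poly_Mapping.keys y. U j)"
    and \<sigma>: "active \<sigma> (capped y)" "weight \<sigma> (capped y) = 1"
  shows "slide F (card (Poly_Mapping.keys y)) x (capped y) = slide F (card \<sigma> - 1) (p \<sigma>) (capped y)"
proof (rule slide_reset[OF admissible_keys[OF y x] \<sigma>])
  have "\<sigma> \<subseteq> supp (capped y)"
    by (rule active_subset_supp[OF \<sigma>(1)]) (simp only: supp_capped[OF y] finite_keys)
  then show "card \<sigma> \<le> card (Poly_Mapping.keys y)"
    by (intro card_mono) (simp_all only: supp_capped[OF y] finite_keys)
qed

lemma some_simplex_point:
  assumes "y \<in> mspace nerve_metric"
  shows "(SOME x. x \<in> (\<Inter>j\<in>Poly_Mapping.keys y. U j)) \<in> (\<Inter>j\<in>Poly_Mapping.keys y. U j)"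
  by (rule someI, rule base_point[OF nerve_point(2)[OF assms]])

lemma from_nerve_reset:
  assumes "y \<in> mspace nerve_metric" "active \<sigma> (capped y)" "weight \<sigma> (capped y) = 1"
  shows "from_nerve y = slide F (card \<sigma> - 1) (p \<sigma>) (capped y)"
  unfolding from_nerve_def by (rule slide_capped[OF assms(1) some_simplex_point[OF assms(1)] assms(2,3)])

lemma full_weight_simplex:
  assumes "y \<in> mspace nerve_metric"
  obtains \<sigma> where "active \<sigma> (capped y)" "1 < 2 ^ (card \<sigma> + 1) * gap \<sigma> (capped y)"
proof -
  obtain i where "capped y i = 1" using capped_reach_1[OF assms] .
  moreover have "finite (supp (capped y))" by (simp only: supp_capped[OF assms] finite_keys)
  ultimately obtain \<sigma> where \<sigma>: "finite \<sigma>" "\<sigma> \<noteq> {}" "1 < 2 ^ (card \<sigma> + 1) * gap \<sigma> (capped y)"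
    using exists_large_gap by metis
  then have "active \<sigma> (capped y)"
    unfolding active_def using weight_1_of_large_gap[OF \<sigma>(3)] by simp
  then show thesis using \<sigma>(3) by (rule that)
qed

lemma from_nerve_eq:
  assumes y: "y \<in> mspace nerve_metric" and x: "x \<in> (\<Inter>j\<in>Poly_Mapping.keys y. U j)"
  shows "from_nerve y = slide F (card (Poly_Mapping.keys y)) x (capped y)"
proof -
  obtain \<sigma> where \<sigma>: "active \<sigma> (capped y)" "1 < 2 ^ (card \<sigma> + 1) * gap \<sigma> (capped y)"
    using full_weight_simplex[OF y] .
  note one = weight_1_of_large_gap[OF \<sigma>(2)]
  show ?thesis
    unfolding from_nerve_reset[OF y \<sigma>(1) one] slide_capped[OF y x \<sigma>(1) one] ..
qed

lemma from_nerve_in_mspace: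
  "y \<in> mspace nerve_metric \<Longrightarrow> from_nerve y \<in> mspace M"
  unfolding from_nerve_def by (rule slide_in_mspace[OF admissible_keys[OF _ some_simplex_point]])

lemma from_nerve_in_U:
  assumes y: "y \<in> mspace nerve_metric" and one: "capped y j = 1"
  shows "from_nerve y \<in> U j"
  unfolding from_nerve_def
proof (rule slide_in_maximal[OF admissible_keys[OF y some_simplex_point[OF y]]])
  have "j \<in> supp (capped y)" using one by simp
  then have "j \<in> Poly_Mapping.keys y" by (simp only: supp_capped[OF y])
  with some_simplex_point[OF y]
  show "(SOME x. x \<in> (\<Inter>j\<in>Poly_Mapping.keys y. U j)) \<in> U j" by (rule INT_D)
  show "capped y k \<le> capped y j" for k using capped_le_1[of y k] one by simp
qed

lemma Lipschitz_vector_near_nerve_lookup: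
  "y \<in> mspace nerve_metric \<Longrightarrow> Lipschitz_vector_near nerve_metric y Poly_Mapping.lookup"
  by (rule Lipschitz_vector_near_lookup[OF star_finite])

lemma Lipschitz_vector_near_capped:
  assumes "y \<in> mspace nerve_metric"
  shows "Lipschitz_vector_near nerve_metric y capped"
  unfolding capped_def
  by (rule Lipschitz_vector_near_cap[OF Lipschitz_vector_near_nerve_lookup[OF assms] assms
        nerve_point(6)[OF assms]])

text \<open>A simplex \<open>\<sigma>\<close> whose gap at \<open>y\<close> exceeds the threshold for weight \<open>1\<close> strictly does so for all
  nearby points. There the map is the \<open>slide\<close> of the fixed point \<open>p \<sigma>\<close> from the level below \<open>\<sigma>\<close>.\<close>

lemma from_nerve_locally_Lipschitz: "locally_Lipschitz_map nerve_metric M from_nerve"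
  unfolding locally_Lipschitz_map_iff
proof (intro conjI ballI Pi_I from_nerve_in_mspace)
  fix y assume y: "y \<in> mspace nerve_metric"
  obtain \<sigma> where \<sigma>: "active \<sigma> (capped y)" "1 < 2 ^ (card \<sigma> + 1) * gap \<sigma> (capped y)"
    using full_weight_simplex[OF y] .
  have fin\<sigma>: "finite \<sigma>" "\<sigma> \<noteq> {}" using \<sigma>(1) by (simp_all add: active_def)
  have nerve: "\<sigma> \<in> nerve J U"
    by (rule active_in_nerve(1)[OF admissible_keys[OF y some_simplex_point[OF y]] \<sigma>(1) order_refl])
  have lip: "Lipschitz_near nerve_metric y dist (\<lambda>v. gap \<sigma> (capped v))"
    by (rule Lipschitz_near_vector_function[OF Lipschitz_vector_near_capped[OF y]])
       (rule gap_diff[OF fin\<sigma>])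
  let ?c = "2 ^ (card \<sigma> + 1) :: real"
  have "0 < gap \<sigma> (capped y) - 1 / ?c" using \<sigma>(2) by (simp add: field_simps)
  from Lipschitz_near_continuous[OF lip y this]
  have large: "\<forall>\<^sub>F v in near nerve_metric y. 1 < ?c * gap \<sigma> (capped v)"
  proof eventually_elim
    case (elim v)
    then have "1 / ?c < gap \<sigma> (capped v)" unfolding dist_real_def by linarith
    then show ?case by (simp add: field_simps)
  qed
  have act: "active \<sigma> (capped v)" if "1 < ?c * gap \<sigma> (capped v)" for v
    using fin\<sigma> weight_1_of_large_gap[OF that] by (simp add: active_def)
  have "\<forall>\<^sub>F v in near nerve_metric y. admissible (card \<sigma> - 1) (p \<sigma>) (capped v)"
    using large eventually_near_mspace[of nerve_metric y]
  proof eventually_elim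
    case (elim v)
    have fin: "finite (supp (capped v))" by (simp only: supp_capped[OF elim(2)] finite_keys)
    show ?case
      unfolding admissible_def
    proof (intro conjI allI impI fin)
      show "p \<sigma> \<in> mspace M"
        using base_point[OF nerve] simplex_subset[OF nerve] by (rule set_rev_mp)
      show "supp (capped v) \<subseteq> J"
        using nerve_point(4)[OF elim(2)] by (simp only: supp_capped[OF elim(2)])
      fix \<tau> assume "active \<tau> (capped v) \<and> card \<tau> \<le> card \<sigma> - 1"
      then have "active \<tau> (capped v)" "card \<tau> \<le> card \<sigma>" by auto
      then have "\<tau> \<subseteq> \<sigma>" by (rule active_chain[OF _ act[OF elim(1)] fin])
      with base_point[OF nerve] show "p \<sigma> \<in> (\<Inter>j\<in>\<tau>. U j)" by blast
    qed
  qed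
  moreover have "Lipschitz_near nerve_metric y (mdist M) (\<lambda>_. p \<sigma>)"
  proof (rule Lipschitz_nearI[where P="\<lambda>_. True" and C=0])
    have "p \<sigma> \<in> mspace M"
      using base_point[OF nerve] simplex_subset[OF nerve] by (rule set_rev_mp)
    then have "mdist M (p \<sigma>) (p \<sigma>) = 0" by simp
    then show "mdist M (p \<sigma>) (p \<sigma>) \<le> 0 * mdist nerve_metric u v" for u v by simp
  qed simp
  ultimately have "Lipschitz_near nerve_metric y (mdist M)
      (\<lambda>v. slide F (card \<sigma> - 1) (p \<sigma>) (capped v))"
    by (intro slide_near Lipschitz_vector_near_capped y)
  then show "Lipschitz_near nerve_metric y (mdist M) from_nerve"
  proof (rule Lipschitz_near_cong)
    show "\<forall>\<^sub>F v in near nerve_metric y. from_nerve v = slide F (card \<sigma> - 1) (p \<sigma>) (capped v)"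
      using large eventually_near_mspace[of nerve_metric y]
      by eventually_elim (rule from_nerve_reset[OF _ act weight_1_of_large_gap])
  qed
qed


section \<open>The two homotopies\<close>

abbreviation cylinder :: "'b metric \<Rightarrow> ('b \<times> real) metric" where
  "cylinder X \<equiv> prod_metric X unit_interval_metric"

lemma Lipschitz_near_time: "Lipschitz_near (cylinder X) q dist snd"
  using Lipschitz_near_prod_snd[of X unit_interval_metric q] by simp

lemma capped_to_nerve:
  assumes "x \<in> mspace M"
  shows "capped (to_nerve x) = cap (depth x)" "Poly_Mapping.keys (to_nerve x) = supp (depth x)"
proof -
  note props = depth_props[OF assms]
  note real = realise_properties[OF props(1) depth_nonneg props(3)]
  show "Poly_Mapping.keys (to_nerve x) = supp (depth x)" unfolding to_nerve_def by (rule real(2))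
  have "Poly_Mapping.lookup (to_nerve x) = (\<lambda>j. 1 / sum (depth x) (supp (depth x)) * depth x j)"
    unfolding to_nerve_def using lookup_realise[OF props(1)] by (simp add: fun_eq_iff)
  then show "capped (to_nerve x) = cap (depth x)"
    unfolding capped_def using cap_scale[OF props(1), of "1 / sum (depth x) (supp (depth x))"] real(1)
    by simp
qed

lemma to_nerve_in_mspace: "x \<in> mspace M \<Longrightarrow> to_nerve x \<in> mspace nerve_metric"
  using to_nerve_locally_Lipschitz unfolding locally_Lipschitz_map_iff by (blast dest: funcset_mem)

text \<open>The starting point \<open>x\<close> lies in all sets of the support of its image, so at \<open>t = 0\<close> sliding \<open>x\<close>
  gives the composite; at \<open>t = 1\<close> the vector is \<open>0\<close>, no simplex is active and \<open>x\<close> rests.\<close>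

lemma from_to_nerve_homotopic:
  "locally_Lipschitz_homotopic M M (from_nerve \<circ> to_nerve) id"
proof -
  define z where "z q = (\<lambda>j. (1 - snd q) * cap (depth (fst q)) j)" for q :: "'a \<times> real"
  define h where "h q = slide F (card (supp (depth (fst q)))) (fst q) (z q)" for q
  have supp_z: "supp (z q) \<subseteq> supp (depth (fst q))" for q
    by (auto simp: z_def cap_def)
  have adm: "admissible n (fst q) (z q)" if "fst q \<in> mspace M" for n q
  proof (rule admissible_of_supp[OF that])
    show "finite (supp (z q))" using supp_z depth_props(1)[OF that] by (rule finite_subset)
    have sub: "supp (z q) \<subseteq> {j\<in>J. fst q \<in> U j}"
      using supp_z[of q] by (simp only: supp_depth[OF that])
    then show "supp (z q) \<subseteq> J" by blast
    show "fst q \<in> U j" if "j \<in> supp (z q)" for j using sub that by blast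
  qed
  have "locally_Lipschitz_map (cylinder M) M h"
    unfolding locally_Lipschitz_map_iff
  proof (intro conjI ballI Pi_I)
    fix q assume q: "q \<in> mspace (cylinder M)"
    then have x: "fst q \<in> mspace M" by auto
    show "h q \<in> mspace M" unfolding h_def by (rule slide_in_mspace[OF adm[OF x]])
    note fst_near = Lipschitz_near_prod_fst[of M unit_interval_metric q] q
    have fst_map: "fst \<in> mspace (cylinder M) \<rightarrow> mspace M" by auto
    have depth_near: "Lipschitz_vector_near (cylinder M) q (\<lambda>q. depth (fst q))"
      by (rule Lipschitz_vector_near_compose[OF fst_near fst_map Lipschitz_vector_near_depth[OF x]])
    have z_near: "Lipschitz_vector_near (cylinder M) q z"
      unfolding z_def
    proof (rule Lipschitz_vector_near_scale[OF _ _ q])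
      show "Lipschitz_vector_near (cylinder M) q (\<lambda>u. cap (depth (fst u)))"
        by (rule Lipschitz_vector_near_cap[OF depth_near q depth_props(4)[OF x]])
      show "Lipschitz_near (cylinder M) q dist (\<lambda>u. 1 - snd u)"
        by (rule Lipschitz_near_diff[OF Lipschitz_near_const Lipschitz_near_time])
    qed
    obtain W where W: "finite W" "\<forall>\<^sub>F u in near (cylinder M) q. supp (depth (fst u)) \<subseteq> W"
      using depth_near unfolding Lipschitz_vector_near_def by blast
    have in_M: "\<forall>\<^sub>F u in near (cylinder M) q. fst u \<in> mspace M"
      using eventually_near_mspace[of "cylinder M" q] by eventually_elim auto
    have "\<forall>\<^sub>F u in near (cylinder M) q. h u = slide F (card W) (fst u) (z u)"
      using W(2)
    proof eventually_elim
      case (elim u)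
      have fin: "finite (supp (depth (fst u)))" using elim W(1) by (rule finite_subset)
      have fin_z: "finite (supp (z u))" using supp_z fin by (rule finite_subset)
      have le: "card (supp (z u)) \<le> card (supp (depth (fst u)))"
        using fin supp_z by (rule card_mono)
      also have "card (supp (depth (fst u))) \<le> card W" using W(1) elim by (rule card_mono)
      finally have le_W: "card (supp (z u)) \<le> card W" .
      show ?case
        unfolding h_def by (rule trans[OF slide_stable[OF fin_z le] slide_stable[OF fin_z le_W, symmetric]])
    qed
    moreover have "Lipschitz_near (cylinder M) q (mdist M) (\<lambda>u. slide F (card W) (fst u) (z u))"
    proof (rule slide_near[OF fst_near(1) z_near])
      show "\<forall>\<^sub>F u in near (cylinder M) q. admissible (card W) (fst u) (z u)"
        using in_M by eventually_elim (rule adm)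
    qed
    ultimately show "Lipschitz_near (cylinder M) q (mdist M) h"
      by (rule Lipschitz_near_cong[rotated])
  qed
  moreover have "h (x, 0) = (from_nerve \<circ> to_nerve) x" if x: "x \<in> mspace M" for x
  proof -
    have "x \<in> (\<Inter>j\<in>Poly_Mapping.keys (to_nerve x). U j)"
      unfolding capped_to_nerve(2)[OF x] supp_depth[OF x] by simp
    from from_nerve_eq[OF to_nerve_in_mspace[OF x] this]
    show ?thesis by (simp add: h_def z_def capped_to_nerve[OF x])
  qed
  moreover have "h (x, 1) = id x" if x: "x \<in> mspace M" for x
    using slide_stable[of "\<lambda>_. 0" "card (supp (depth x))" F x] by (simp add: h_def z_def)
  ultimately show ?thesis
    unfolding locally_Lipschitz_homotopic_def by (intro exI[of _ h]) simp
qed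

text \<open>The composite at \<open>y\<close> and \<open>y\<close> itself need not lie in a common simplex, but \<open>core y\<close>, the part of
  \<open>y\<close> above half its maximum, shares a simplex with either: its support is contained in that of
  \<open>y\<close>, and the image of \<open>y\<close> in \<open>M\<close> lies in \<open>U j\<close> for each \<open>j\<close> in it. The homotopy passes through
  \<open>core y\<close> at \<open>t = 1/2\<close>; the three coefficient functions of \<open>t\<close> put this into one formula, with no
  concatenation of homotopies.\<close>

lemma to_from_nerve_homotopic:
  "locally_Lipschitz_homotopic nerve_metric nerve_metric (to_nerve \<circ> from_nerve) id"
proof -
  define core where "core y = (\<lambda>j. max 0 (Poly_Mapping.lookup y j - peak (Poly_Mapping.lookup y) / 2))"
    for y :: "'j \<Rightarrow>\<^sub>0 real"
  define v where "v q = (\<lambda>j. max 0 (1 - 2 * snd q) * depth (from_nerve (fst q)) j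
      + (min (2 * snd q) (2 - 2 * snd q) * core (fst q) j
      + max 0 (2 * snd q - 1) * Poly_Mapping.lookup (fst q) j))" for q :: "('j \<Rightarrow>\<^sub>0 real) \<times> real"
  have core_nonneg: "0 \<le> core y j" for y j by (simp add: core_def)
  have core_one: "capped y j = 1" if "y \<in> mspace nerve_metric" "core y j \<noteq> 0" for y j
    using that(2) unfolding capped_def cap_eq_1_iff[OF nerve_point(6)[OF that(1)]]
    by (auto simp: core_def max_def split: if_splits)
  have core_keys: "j \<in> Poly_Mapping.keys y" if y: "y \<in> mspace nerve_metric" and "core y j \<noteq> 0" for y j
  proof -
    have "j \<in> supp (capped y)" using core_one[OF that] by simp
    then show ?thesis by (simp only: supp_capped[OF y])
  qed
  have v_nonneg: "0 \<le> v q j" if q: "q \<in> mspace (cylinder nerve_metric)" for q j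
  proof -
    have "fst q \<in> mspace nerve_metric" "0 \<le> snd q" "snd q \<le> 1" using q by auto
    then show ?thesis
      unfolding v_def
      by (intro add_nonneg_nonneg mult_nonneg_nonneg depth_nonneg core_nonneg nerve_point(1)) auto
  qed
  have v_supp: "supp (v q) \<in> nerve J U" if q: "q \<in> mspace (cylinder nerve_metric)" for q
  proof -
    have y: "fst q \<in> mspace nerve_metric" and t: "0 \<le> snd q" "snd q \<le> 1" using q by auto
    note x = from_nerve_in_mspace[OF y]
    have ne: "supp (v q) \<noteq> {}"
    proof (cases "snd q = 0")
      case True
      then have "v q = depth (from_nerve (fst q))" by (simp add: v_def fun_eq_iff)
      then show ?thesis using depth_props(3)[OF x] by simp
    next
      case False
      have fin: "finite (supp (Poly_Mapping.lookup (fst q)))" by (simp only: supp_lookup finite_keys)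
      obtain i where i: "Poly_Mapping.lookup (fst q) i = peak (Poly_Mapping.lookup (fst q))"
        using peak_attained[OF fin nerve_point(6)[OF y]] .
      have pos: "0 < core (fst q) i" "0 < Poly_Mapping.lookup (fst q) i"
        using i nerve_point(6)[OF y] by (simp_all add: core_def)
      have 1: "0 \<le> max 0 (1 - 2 * snd q) * depth (from_nerve (fst q)) i"
        by (intro mult_nonneg_nonneg depth_nonneg) simp
      have 2: "0 \<le> min (2 * snd q) (2 - 2 * snd q) * core (fst q) i"
        using t by (intro mult_nonneg_nonneg core_nonneg) simp
      have 3: "0 \<le> max 0 (2 * snd q - 1) * Poly_Mapping.lookup (fst q) i"
        using pos(2) by (intro mult_nonneg_nonneg) simp_all
      have "0 < v q i"
      proof (cases "snd q = 1")
        case True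
        with pos(2) show ?thesis by (simp add: v_def)
      next
        case False
        with \<open>snd q \<noteq> 0\<close> t pos(1) have "0 < min (2 * snd q) (2 - 2 * snd q) * core (fst q) i"
          by (intro mult_pos_pos) simp_all
        with 1 3 show ?thesis unfolding v_def by linarith
      qed
      then show ?thesis by force
    qed
    show ?thesis
    \<comment> \<open>In the first half of the homotopy \<open>y\<close> itself has coefficient \<open>0\<close>, in the second half
        the image of \<open>y\<close> has.\<close>
    proof (cases "snd q \<le> 1 / 2")
      case True
      have "supp (v q) \<subseteq> {j\<in>J. from_nerve (fst q) \<in> U j}"
      proof
        fix j assume "j \<in> supp (v q)"
        with True have "depth (from_nerve (fst q)) j \<noteq> 0 \<or> core (fst q) j \<noteq> 0"
          by (auto simp: v_def)
        then show "j \<in> {j\<in>J. from_nerve (fst q) \<in> U j}"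
        proof
          assume "core (fst q) j \<noteq> 0"
          with from_nerve_in_U[OF y core_one[OF y]] core_keys[OF y] nerve_point(4)[OF y]
          show ?thesis by auto
        qed (simp add: depth_nonzero_iff[OF x])
      qed
      from nerve_closed(2)[OF containing_simplex[OF x] this ne] show ?thesis .
    next
      case False
      have "supp (v q) \<subseteq> Poly_Mapping.keys (fst q)"
      proof
        fix j assume "j \<in> supp (v q)"
        with False have "core (fst q) j \<noteq> 0 \<or> Poly_Mapping.lookup (fst q) j \<noteq> 0"
          by (auto simp: v_def)
        then show "j \<in> Poly_Mapping.keys (fst q)"
          using core_keys[OF y] by (auto simp: in_keys_iff)
      qed
      from nerve_closed(2)[OF nerve_point(2)[OF y] this ne] show ?thesis .
    qed
  qed
  have core_near: "Lipschitz_vector_near nerve_metric y core" if y: "y \<in> mspace nerve_metric" for y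
  proof -
    note lookup = Lipschitz_vector_near_nerve_lookup[OF y]
    obtain W where W: "finite W" "\<forall>\<^sub>F u in near nerve_metric y. supp (Poly_Mapping.lookup u) \<subseteq> W"
      using lookup unfolding Lipschitz_vector_near_def by blast
    show ?thesis
    proof (rule Lipschitz_vector_nearI[OF W(1)])
      show "\<forall>\<^sub>F u in near nerve_metric y. supp (core u) \<subseteq> W"
        using W(2) eventually_near_mspace[of nerve_metric y]
      proof eventually_elim
        case (elim u)
        have "supp (core u) \<subseteq> Poly_Mapping.keys u" using core_keys[OF elim(2)] by auto
        with elim(1) show ?case by (simp only: supp_lookup)
      qed
      show "Lipschitz_near nerve_metric y dist (\<lambda>u. core u j)" for j
        unfolding core_def
        using Lipschitz_near_peak[OF lookup] Lipschitz_vector_near_coordinate[OF lookup, of j]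
        by (intro Lipschitz_near_max Lipschitz_near_diff Lipschitz_near_divide Lipschitz_near_const y)
           simp_all
    qed
  qed
  have v_near: "Lipschitz_vector_near (cylinder nerve_metric) q v"
    if q: "q \<in> mspace (cylinder nerve_metric)" for q
  proof -
    have y: "fst q \<in> mspace nerve_metric" using q by auto
    have fst_map: "fst \<in> mspace (cylinder nerve_metric) \<rightarrow> mspace nerve_metric" by auto
    have g: "Lipschitz_near nerve_metric (fst q) (mdist M) from_nerve"
      "from_nerve \<in> mspace nerve_metric \<rightarrow> mspace M"
      using from_nerve_locally_Lipschitz y unfolding locally_Lipschitz_map_iff by simp_all
    note lift = Lipschitz_vector_near_compose[OF Lipschitz_near_prod_fst[of nerve_metric
        unit_interval_metric q] q fst_map]
    note times = Lipschitz_near_const Lipschitz_near_time Lipschitz_near_max Lipschitz_near_min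
      Lipschitz_near_diff Lipschitz_near_mult q
    show ?thesis
      unfolding v_def
    proof (intro Lipschitz_vector_near_add Lipschitz_vector_near_scale)
      show "Lipschitz_vector_near (cylinder nerve_metric) q (\<lambda>u. depth (from_nerve (fst u)))"
        by (rule lift[OF Lipschitz_vector_near_compose[OF g(1) y g(2)
              Lipschitz_vector_near_depth[OF from_nerve_in_mspace[OF y]]]])
      show "Lipschitz_vector_near (cylinder nerve_metric) q (\<lambda>u. core (fst u))"
        by (rule lift[OF core_near[OF y]])
      show "Lipschitz_vector_near (cylinder nerve_metric) q (\<lambda>u. Poly_Mapping.lookup (fst u))"
        by (rule lift[OF Lipschitz_vector_near_nerve_lookup[OF y]])
    qed (rule q | intro times)+
  qed
  have "locally_Lipschitz_map (cylinder nerve_metric) nerve_metric (\<lambda>q. realise (v q))"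
    by (rule locally_Lipschitz_realise[OF nerve_closed])
       (assumption | rule v_supp v_nonneg v_near)+
  moreover have "realise (v (y, 0)) = (to_nerve \<circ> from_nerve) y" for y
    by (simp add: v_def to_nerve_def)
  moreover have "realise (v (y, 1)) = id y" if "y \<in> mspace nerve_metric" for y
    using realise_lookup[OF nerve_point(3)[OF that]] by (simp add: v_def)
  ultimately show ?thesis
    unfolding locally_Lipschitz_homotopic_def by (intro exI[of _ "\<lambda>q. realise (v q)"]) simp
qed

end


section \<open>Good coverings\<close>

text \<open>The compact closure of \<open>U j\<close> is covered by finitely many open sets each of which meets only
  finitely many members of the covering.\<close>

lemma good_covering_star_finite:
  assumes good: "good_covering X J U" and j: "j \<in> J"
  shows "finite {k\<in>J. U j \<inter> U k \<noteq> {}}"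
proof -
  let ?C = "mtopology_of X closure_of U j"
  define \<V> where "\<V> = {V. openin (mtopology_of X) V \<and> finite {k\<in>J. U k \<inter> V \<noteq> {}}}"
  have cover: "locally_finite_open_covering X J U" and comp: "compactin (mtopology_of X) ?C"
    using good j unfolding good_covering_def by auto
  have "?C \<subseteq> \<Union>\<V>"
  proof
    fix x assume "x \<in> ?C"
    then have "x \<in> mspace X" using closure_of_subset_topspace[of "mtopology_of X" "U j"] by auto
    then obtain V where "openin (mtopology_of X) V" "x \<in> V" "finite {k\<in>J. U k \<inter> V \<noteq> {}}"
      using cover unfolding locally_finite_open_covering_def by blast
    then show "x \<in> \<Union>\<V>" by (intro UnionI[of V]) (simp_all add: \<V>_def)
  qed
  moreover have "\<forall>V\<in>\<V>. openin (mtopology_of X) V" by (simp add: \<V>_def)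
  moreover have "\<forall>\<U>. (\<forall>V\<in>\<U>. openin (mtopology_of X) V) \<and> ?C \<subseteq> \<Union>\<U> \<longrightarrow>
      (\<exists>\<F>. finite \<F> \<and> \<F> \<subseteq> \<U> \<and> ?C \<subseteq> \<Union>\<F>)"
    using comp unfolding compactin_def by (rule conjunct2)
  ultimately have "\<exists>\<F>. finite \<F> \<and> \<F> \<subseteq> \<V> \<and> ?C \<subseteq> \<Union>\<F>" by simp
  then obtain \<F> where \<F>: "finite \<F>" "\<F> \<subseteq> \<V>" "?C \<subseteq> \<Union>\<F>"
    by (elim exE conjE) (rule that)
  have "openin (mtopology_of X) (U j)"
    using cover j unfolding locally_finite_open_covering_def by blast
  then have "U j \<subseteq> ?C" by (intro closure_of_subset) (rule openin_subset)
  with \<F>(3) have "{k\<in>J. U j \<inter> U k \<noteq> {}} \<subseteq> (\<Union>V\<in>\<F>. {k\<in>J. U k \<inter> V \<noteq> {}})" by blast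
  moreover have "finite (\<Union>V\<in>\<F>. {k\<in>J. U k \<inter> V \<noteq> {}})"
    using \<F>(1,2) by (intro finite_UN_I) (auto simp: \<V>_def)
  ultimately show ?thesis by (rule finite_subset)
qed

lemma good_covering_contractions:
  assumes "good_covering X J U"
  obtains F p where "contractible_cover X J U F p"
proof -
  have retraction: "\<exists>c. fst c \<in> (\<Inter>j\<in>\<sigma>. U j) \<and>
      Lipschitz_strong_deformation_retraction (submetric X (\<Inter>j\<in>\<sigma>. U j)) {fst c} (snd c)"
    if "\<sigma> \<subseteq> J \<and> finite \<sigma> \<and> \<sigma> \<noteq> {} \<and> (\<Inter>j\<in>\<sigma>. U j) \<noteq> {}" for \<sigma>
  proof -
    have "\<forall>s. s \<subseteq> J \<and> finite s \<and> s \<noteq> {} \<and> (\<Inter>j\<in>s. U j) \<noteq> {} \<longrightarrow>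
        (\<exists>q\<in>(\<Inter>j\<in>s. U j). \<exists>G.
           Lipschitz_strong_deformation_retraction (submetric X (\<Inter>j\<in>s. U j)) {q} G)"
      using assms unfolding good_covering_def by (elim conjE)
    from mp[OF spec[OF this] that] obtain q G where "q \<in> (\<Inter>j\<in>\<sigma>. U j)"
      "Lipschitz_strong_deformation_retraction (submetric X (\<Inter>j\<in>\<sigma>. U j)) {q} G"
      by (elim bexE exE)
    then show ?thesis by (intro exI[of _ "(q, G)"]) (simp only: fst_conv snd_conv)
  qed
  have "\<forall>\<sigma>\<in>nerve J U. \<exists>c. fst c \<in> (\<Inter>j\<in>\<sigma>. U j) \<and>
      Lipschitz_strong_deformation_retraction (submetric X (\<Inter>j\<in>\<sigma>. U j)) {fst c} (snd c)"
  proof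
    fix \<sigma> assume "\<sigma> \<in> nerve J U"
    then have "\<sigma> \<subseteq> J \<and> finite \<sigma> \<and> \<sigma> \<noteq> {} \<and> (\<Inter>j\<in>\<sigma>. U j) \<noteq> {}"
      unfolding nerve_def by (rule CollectD)
    then show "\<exists>c. fst c \<in> (\<Inter>j\<in>\<sigma>. U j) \<and>
        Lipschitz_strong_deformation_retraction (submetric X (\<Inter>j\<in>\<sigma>. U j)) {fst c} (snd c)"
      by (rule retraction)
  qed
  from bchoice[OF this] obtain c where c: "\<forall>\<sigma>\<in>nerve J U. fst (c \<sigma>) \<in> (\<Inter>j\<in>\<sigma>. U j) \<and>
      Lipschitz_strong_deformation_retraction (submetric X (\<Inter>j\<in>\<sigma>. U j)) {fst (c \<sigma>)} (snd (c \<sigma>))"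
    by (elim exE) (rule that)
  have "contractible_cover X J U (\<lambda>\<sigma>. snd (c \<sigma>)) (\<lambda>\<sigma>. fst (c \<sigma>))"
  proof
    show "locally_finite_open_covering X J U"
      using assms unfolding good_covering_def by (rule conjunct1)
    show "finite {k\<in>J. U j \<inter> U k \<noteq> {}}" if "j \<in> J" for j
      using assms that by (rule good_covering_star_finite)
    fix \<sigma> assume "\<sigma> \<in> nerve J U"
    from bspec[OF c this]
    show "fst (c \<sigma>) \<in> (\<Inter>j\<in>\<sigma>. U j)"
      "Lipschitz_strong_deformation_retraction (submetric X (\<Inter>j\<in>\<sigma>. U j)) {fst (c \<sigma>)} (snd (c \<sigma>))"
      by (rule conjunct1, rule conjunct2)
  qed
  then show thesis by (rule that)
qed

theorem theorem1p1:
  fixes M :: "'a metric" and J :: "'j set" and U :: "'j \<Rightarrow> 'a set"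
  assumes "sigma_compact_space (mtopology_of M)"
    and "good_covering M J U"
  shows "locally_Lipschitz_homotopy_equivalent M (geometric_realization (nerve J U))"
proof -
  obtain F p where "contractible_cover M J U F p"
    using good_covering_contractions[OF assms(2)] .
  then interpret contractible_cover M J U F p .
  show ?thesis
    unfolding locally_Lipschitz_homotopy_equivalent_def
    using to_nerve_locally_Lipschitz from_nerve_locally_Lipschitz
      from_to_nerve_homotopic to_from_nerve_homotopic
    by (intro exI conjI)
qed

end
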